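(* For all integers $n, r \ge 0$ the following hold. 1. The number $p^{(r)}_{2,1}(n) = \#\{\lambda \vdash n \mid \mathrm{mex}_{2,1}(\lambda) = 2r+1\}$ equals the number of partitions $\lambda \vdash n$ with $\mathrm{sqrank}(\lambda) = r$. 2. The number $p^{(r)}_{2,2}(n) = \#\{\lambda \vdash n \mid \mathrm{mex}_{2,2}(\lambda) = 2r+2\}$ equals the number of partitions $\lambda \vdash n$ with $\mathrm{rerank}(\lambda) = r$.
   Context: A partition of $n$ is a finite weakly decreasing sequence of positive integers (its parts) with sum $n$; the empty partition $\emptyset$ is the only partition of $0$. Write $\lambda \vdash n$. Partitions are identified with their Ferrers diagrams, whose cells have matrix coordinates $(i,j)$ (row $i$, column $j$). $\mathrm{mex}_{2,1}(\lambda)$ (resp. $\mathrm{mex}_{2,2}(\lambda)$) is the smallest positive odd (resp. even) integer that is not a part of $\lambda$; in particular $\mathrm{mex}_{2,1}(\emptyset)=1$ and $\mathrm{mex}_{2,2}(\emptyset)=2$. Frobenius representation: if the main diagonal of $\lambda$ consists of the $d$ cells $(i,i)$, $1 \le i \le d$, let $x_i$ be the number of cells in row $i$ strictly to the right of $(i,i)$ and $y_i$ the number of cells in column $i$ strictly below $(i,i)$; then $F(\lambda) = (x_1,\dots,x_d \mid y_1,\dots,y_d)$. A rim hook is an edgewise connected skew diagram containing no $2\times 2$ block of cells; its length is its number of cells, and its arm length is one less than the number of columns it occupies. The rim of a diagram is the rim hook consisting of all cells along its south-east border, i.e. of all cells $(i,j)$ of the diagram such that $(i+1,j+1)$ is not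 in the diagram. Definition of $\mathrm{sqrank} = f^{(0)}$ and $\mathrm{rerank} = f^{(1)}$. For a partition $\lambda$ and $a \in \{0,1\}$: (1) Let $D_0(\lambda)$ be the Durfee square of $\lambda$ (the largest square contained in $\lambda$ with a corner at cell $(1,1)$), and let $D_1(\lambda)$ be the largest rectangle contained in $\lambda$ with a corner at cell $(1,1)$ whose horizontal side length exceeds its vertical side length by one. Let $n_a$ be the vertical side length of $D_a(\lambda)$ (so $n_a=\max\{m\ge 0: m=0 \text{ or } \lambda_m \ge m+a\}$). Let $A_a(\lambda)$ be the sub-diagram of $\lambda$ consisting of the cells in the first $n_a$ rows but not in $D_a(\lambda)$, regarded as the partition $(\lambda_1 - n_a - a, \dots, \lambda_{n_a} - n_a - a)$ with zeros omitted. If $\lambda=\emptyset$, then $D_0(\lambda)=A_0(\lambda)=\emptyset$ and $n_0=0$; if $\lambda=\emptyset$ or all parts of $\lambda$ are $1$, then $D_1(\lambda)=A_1(\lambda)=\emptyset$ and $n_1=0$. (2) From the diagram $A_a(\lambda)$ strip away the longest of the rightmost rim hooks with arm length $n_a+a$ lying along the rim of the diagram (that is, remove all rim cells lying in the rightmost $n_a+a+1$ columns of the diagram). Repeat the same procedure until the remaining diagram has less than $n_a+a+1$ columns. Call the residual diagram $R_a(\lambda)$. (3) Let $F(R_a(\lambda)) = (x_1,\dots,x_d \mid y_1,\dots,y_d)$ (with $d=0$ if $R_a(\lambda)=\emptyset$), set $y_0 = n_a$ and $x_{d+1} = -1$, and define $$f^{(a)}(\lambda) = \max_{0 \le i \le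 d} (y_i - x_{i+1}) - 1 .$$ (If $R_a(\lambda)=\emptyset$ this gives $f^{(a)}(\lambda)=n_a$.) *)

theory Defs
  imports Main "HOL-Library.While_Combinator"
begin

definition partitions_of :: "nat \<Rightarrow> nat list set" where
  "partitions_of n =
     {l. sorted_wrt (\<ge>) l \<and> (\<forall>p\<in>set l. 0 < p) \<and> sum_list l = n}"

lemma finite_partitions_of: "finite (partitions_of n)"
proof -
  have *: "length l \<le> sum_list l" if "\<forall>p\<in>set l. 0 < p" for l :: "nat list"
    using that by (induction l) auto
  have "partitions_of n \<subseteq> {l. set l \<subseteq> {..n} \<and> length l \<le> n}"
    using * by (auto simp: partitions_of_def dest: member_le_sum_list)
  then show ?thesis
    using finite_lists_length_le[of "{..n}" n] finite_subset by blast
qed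

definition mex21 :: "nat list \<Rightarrow> nat" where
  "mex21 l = (LEAST k. 0 < k \<and> odd k \<and> k \<notin> set l)"

definition mex22 :: "nat list \<Rightarrow> nat" where
  "mex22 l = (LEAST k. 0 < k \<and> even k \<and> k \<notin> set l)"

(* Cells are pairs (row, column), both counted from 1. *)
type_synonym diagram = "(nat \<times> nat) set"

definition ferrers :: "nat list \<Rightarrow> diagram" where
  "ferrers l = {(i, j). 1 \<le> i \<and> i \<le> length l \<and> 1 \<le> j \<and> j \<le> l ! (i - 1)}"

(* The vertical side of the largest m x (m + a) rectangle at the corner (1,1).
   For m = 0 the rectangle is empty, so the condition always holds there. *)
definition durfee :: "nat \<Rightarrow> nat list \<Rightarrow> nat" where
  "durfee a l = (GREATEST m. {1..m} \<times> {1..m + a} \<subseteq> ferrers l)"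

definition right_part :: "nat \<Rightarrow> nat list \<Rightarrow> nat list" where
  "right_part a l =
     filter (\<lambda>p. 0 < p) (map (\<lambda>p. p - (durfee a l + a)) (take (durfee a l) l))"

definition num_cols :: "diagram \<Rightarrow> nat" where
  "num_cols D = Max (insert 0 (snd ` D))"

definition rim :: "diagram \<Rightarrow> diagram" where
  "rim D = {(i, j). (i, j) \<in> D \<and> (i + 1, j + 1) \<notin> D}"

(* The longest rightmost rim hook with arm length m - 1 along the rim of D is the
   set of all rim cells in the rightmost m columns. If D has c columns,
   these columns are the ones with index j > c - m, stated as
   c < j + m to avoid truncated subtraction. *)
definition strip_hook :: "nat \<Rightarrow> diagram \<Rightarrow> diagram" where
  "strip_hook m D = D - {(i, j). (i, j) \<in> rim D \<and> num_cols D < j + m}"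

definition strip_all :: "nat \<Rightarrow> diagram \<Rightarrow> diagram" where
  "strip_all m D = while (\<lambda>E. m \<le> num_cols E) (strip_hook m) D"

(* The iteration stops on every finite diagram, so strip_all is never an
   unspecified value of the while combinator. *)
lemma strip_all_terminates:
  assumes "finite D" "0 < m"
  shows "\<exists>E. while_option (\<lambda>E. m \<le> num_cols E) (strip_hook m) D = Some E"
proof (rule measure_while_option_Some[where P = finite and f = card])
  fix E :: diagram
  assume fin: "finite E" and m: "m \<le> num_cols E"
  have bound: "j \<le> num_cols E" if "(i, j) \<in> E" for i j
    using fin that unfolding num_cols_def by (intro Max_ge) force+
  have "num_cols E \<in> insert 0 (snd ` E)"
    unfolding num_cols_def using fin by (intro Max_in) auto
  then obtain i where i: "(i, num_cols E) \<in> E"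
    using m assms(2) by auto
  have "(i + 1, num_cols E + 1) \<notin> E"
    using bound[of "i + 1" "num_cols E + 1"] by auto
  then have "(i, num_cols E) \<notin> strip_hook m E"
    using i assms(2) by (simp add: strip_hook_def rim_def)
  then have "strip_hook m E \<subset> E"
    using i by (auto simp: strip_hook_def)
  then show "finite (strip_hook m E) \<and> card (strip_hook m E) < card E"
    using fin by (auto intro: psubset_card_mono finite_subset)
qed (use assms in simp)

definition residual :: "nat \<Rightarrow> nat list \<Rightarrow> diagram" where
  "residual a l = strip_all (durfee a l + a + 1) (ferrers (right_part a l))"

definition diag_len :: "diagram \<Rightarrow> nat" where
  "diag_len D = card {i. (i, i) \<in> D}"

definition frob_arm :: "diagram \<Rightarrow> nat \<Rightarrow> nat" where
  "frob_arm D i = card {j. i < j \<and> (i, j) \<in> D}"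

definition frob_leg :: "diagram \<Rightarrow> nat \<Rightarrow> nat" where
  "frob_leg D i = card {k. i < k \<and> (k, i) \<in> D}"

definition hook_rank :: "nat \<Rightarrow> nat list \<Rightarrow> int" where
  "hook_rank a l =
    (let R = residual a l;
         d = diag_len R;
         x = (\<lambda>i. if i = d + 1 then - 1 else int (frob_arm R i));
         y = (\<lambda>i. if i = 0 then int (durfee a l) else int (frob_leg R i))
     in Max ((\<lambda>i. y i - x (i + 1)) ` {0..d}) - 1)"

definition sqrank :: "nat list \<Rightarrow> int" where
  "sqrank l = hook_rank 0 l"

definition rerank :: "nat list \<Rightarrow> int" where
  "rerank l = hook_rank 1 l"

end

theory Submission
  imports Defs "HOL-Library.Multiset"
begin

text \<open>Fix \<open>a \<in> {0, 1}\<close>. It suffices to count, for each \<open>r\<close>, the partitions of \<open>n\<close> for which the statistic is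
at least \<open>r\<close> (for the mex: at least \<open>2 * r + 1 + a\<close>), and to take differences. On both sides the
count is the number of partitions of \<open>n - r * (r + a)\<close>.

For the mex this is immediate: the mex is that large iff the first \<open>r\<close> odd (even) integers are parts,
and their sum is \<open>r * (r + a)\<close> (\<open>card_partitions_containing\<close>).

For the hook rank, let \<open>m\<close> be the vertical side of the Durfee rectangle of a partition of \<open>n\<close>. Stripping
hooks from the part to the right of the rectangle is reversible: it leaves a residual diagram \<open>D\<close> in an
\<open>m\<close> by \<open>m + a\<close> box, and the hook lengths form an arbitrary multiset of integers between \<open>m + a + 1\<close> and
\<open>2 * m + a\<close>. Joined with the rows below the rectangle, which have length at most \<open>m + a\<close>, they
form a multiset \<open>P\<close> of parts up to \<open>2 * m + a\<close>. So partitions of \<open>n\<close> correspond to triples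
\<open>(m, D, P)\<close> with \<open>m * (m + a) + |D| + |P| = n\<close> (\<open>bij_betw_assemble\<close>), and this holds for every \<open>a\<close>, not
only for \<open>0\<close> and \<open>1\<close>.

The rank depends on \<open>m\<close> and \<open>D\<close> only: it is at least \<open>r\<close> iff \<open>y\<^sub>i - x\<^bsub>i+1\<^esub> > r\<close> for some \<open>i\<close>, where
\<open>(x | y)\<close> are the Frobenius coordinates of \<open>D\<close> with the boundary values \<open>y\<^sub>0 = m\<close> and
\<open>x\<^bsub>d+1\<^esub> = - 1\<close>. As in the reflection principle, exchanging tails at the first such \<open>i\<close>,

  \<open>(x\<^sub>1 + r, ..., x\<^sub>i + r, y\<^bsub>i+1\<^esub>, ..., y\<^sub>d | y\<^sub>1 - r, ..., y\<^sub>i - r, x\<^bsub>i+1\<^esub>, ..., x\<^sub>d)\<close>,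

is a size-preserving bijection from these diagrams onto all diagrams in an \<open>m - r\<close> by \<open>m + a + r\<close> box
(\<open>tail_swap\<close>). The resulting triples \<open>(m - r, D', P)\<close> are the triples for \<open>a + 2 * r\<close> in place of \<open>a\<close>,
and the rectangle has lost \<open>r * (r + a)\<close> cells; hence they correspond to all partitions
of \<open>n - r * (r + a)\<close> (\<open>card_hook_rank_ge\<close>).
\<close>

section \<open>Young diagrams and column heights\<close>

definition young :: "diagram set" where
  "young = {D. finite D \<and> (\<forall>i j. (i, j) \<in> D \<longrightarrow> 1 \<le> i \<and> 1 \<le> j) \<and>
     (\<forall>i j i' j'. (i, j) \<in> D \<longrightarrow> 1 \<le> i' \<longrightarrow> i' \<le> i \<longrightarrow> 1 \<le> j' \<longrightarrow> j' \<le> j \<longrightarrow> (i', j') \<in> D)}"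

text \<open>Column heights of a Young diagram, read as a weakly decreasing function that is eventually zero.
Functions rather than lists: no case distinction is needed at the right end of the diagram, where
truncated subtraction and the value \<open>0\<close> do the right thing. Columns are counted from \<open>0\<close>
here, whereas cells are counted from \<open>1\<close>.\<close>

definition profile :: "(nat \<Rightarrow> nat) set" where
  "profile = {h. antimono h \<and> (\<exists>N. h N = 0)}"

definition diagram_of :: "(nat \<Rightarrow> nat) \<Rightarrow> diagram" where
  "diagram_of h = {(i, j). 1 \<le> i \<and> 1 \<le> j \<and> i \<le> h (j - 1)}"

definition heights :: "diagram \<Rightarrow> nat \<Rightarrow> nat" where
  "heights D j = card {i. (i, Suc j) \<in> D}"

definition conjugate :: "(nat \<Rightarrow> nat) \<Rightarrow> nat \<Rightarrow> nat" where
  "conjugate h i = (LEAST j. h j \<le> i)"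

abbreviation width :: "(nat \<Rightarrow> nat) \<Rightarrow> nat" where
  "width h \<equiv> conjugate h 0"

definition weight :: "(nat \<Rightarrow> nat) \<Rightarrow> nat" where
  "weight h = (\<Sum>j<width h. h j)"

lemma profileD: "h \<in> profile \<Longrightarrow> i \<le> j \<Longrightarrow> h j \<le> h i"
  by (auto simp: profile_def antimono_def)

text \<open>The Galois connection between row and column lengths; every property of conjugation used below
follows from it.\<close>

lemma conjugate_le_iff:
  assumes "h \<in> profile"
  shows "conjugate h i \<le> j \<longleftrightarrow> h j \<le> i"
proof
  obtain N where "h N = 0" using assms by (auto simp: profile_def)
  then have "h N \<le> i" by simp
  then have "h (conjugate h i) \<le> i" unfolding conjugate_def by (rule LeastI)
  moreover assume "conjugate h i \<le> j"
  ultimately show "h j \<le> i" using profileD[OF assms] le_trans by blast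
qed (simp add: conjugate_def Least_le)

lemma less_conjugate_iff: "h \<in> profile \<Longrightarrow> j < conjugate h i \<longleftrightarrow> i < h j"
  using conjugate_le_iff by (metis not_le)

lemma zero_iff_width_le: "h \<in> profile \<Longrightarrow> h j = 0 \<longleftrightarrow> width h \<le> j"
  using conjugate_le_iff[of h 0 j] by auto

lemma conjugate_profile: assumes "h \<in> profile" shows "conjugate h \<in> profile"
proof -
  have "conjugate h j \<le> conjugate h i" if "i \<le> j" for i j
    using that conjugate_le_iff[OF assms] by (meson le_trans order_refl)
  moreover have "conjugate h (h 0) = 0"
    using conjugate_le_iff[OF assms, of "h 0" 0] by simp
  ultimately show ?thesis by (auto simp: profile_def antimono_def)
qed

lemma conjugate_conjugate:
  assumes "h \<in> profile" shows "conjugate (conjugate h) = h"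
proof
  fix j
  have "conjugate (conjugate h) j \<le> i \<longleftrightarrow> h j \<le> i" for i
    by (simp add: conjugate_le_iff conjugate_profile assms)
  then show "conjugate (conjugate h) j = h j" by (meson dual_order.antisym order_refl)
qed

lemma diagram_of_conjugate:
  assumes "h \<in> profile"
  shows "diagram_of (conjugate h) = prod.swap ` diagram_of h"
proof -
  have "(i, j) \<in> diagram_of (conjugate h) \<longleftrightarrow> (j, i) \<in> diagram_of h" for i j
    using less_conjugate_iff[OF assms, of "i - 1" "j - 1"]
    by (auto simp: diagram_of_def)
  then show ?thesis by (force simp: image_iff)
qed

lemma weight_eq_sum:
  assumes "h \<in> profile" "h N = 0"
  shows "weight h = (\<Sum>j<N. h j)"
  unfolding weight_def using assms zero_iff_width_le
  by (intro sum.mono_neutral_left) auto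

lemma diagram_of_eq_image:
  assumes "h \<in> profile"
  shows "diagram_of h = (\<lambda>(j, i). (Suc i, Suc j)) ` Sigma {..<width h} (\<lambda>j. {..<h j})"
proof -
  have "j < width h" if "i < h j" for i j
    using that less_conjugate_iff[OF assms, of j 0] by simp
  moreover have "(i, j) \<in> diagram_of h \<longleftrightarrow> (\<exists>i' j'. i = Suc i' \<and> j = Suc j' \<and> i' < h j')" for i j
    by (cases i; cases j) (simp_all add: diagram_of_def Suc_le_eq)
  ultimately show ?thesis by (auto simp: image_iff)
qed

lemma finite_diagram_of: "h \<in> profile \<Longrightarrow> finite (diagram_of h)"
  by (simp add: diagram_of_eq_image)

lemma card_diagram_of: "h \<in> profile \<Longrightarrow> card (diagram_of h) = weight h"
  by (subst diagram_of_eq_image) (auto simp: card_image inj_on_def weight_def)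

lemma weight_conjugate: "h \<in> profile \<Longrightarrow> weight (conjugate h) = weight h"
  by (simp add: card_diagram_of[symmetric] conjugate_profile diagram_of_conjugate card_image)

lemma heights_diagram_of: "heights (diagram_of h) = h"
proof
  fix j
  have "{i. (i, Suc j) \<in> diagram_of h} = {1..h j}" by (auto simp: diagram_of_def)
  then show "heights (diagram_of h) j = h j" by (simp add: heights_def)
qed

lemma youngI:
  assumes "finite D" "\<And>i j. (i, j) \<in> D \<Longrightarrow> 1 \<le> i \<and> 1 \<le> j"
    "\<And>i j i' j'. (i, j) \<in> D \<Longrightarrow> 1 \<le> i' \<Longrightarrow> i' \<le> i \<Longrightarrow> 1 \<le> j' \<Longrightarrow> j' \<le> j \<Longrightarrow> (i', j') \<in> D"
  shows "D \<in> young"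
  unfolding young_def using assms by blast

lemma young_downD:
  "D \<in> young \<Longrightarrow> (i, j) \<in> D \<Longrightarrow> 1 \<le> i' \<Longrightarrow> i' \<le> i \<Longrightarrow> 1 \<le> j' \<Longrightarrow> j' \<le> j \<Longrightarrow> (i', j') \<in> D"
  unfolding young_def by blast

lemma young_posD: "D \<in> young \<Longrightarrow> (i, j) \<in> D \<Longrightarrow> 1 \<le> i \<and> 1 \<le> j"
  unfolding young_def by blast

lemma young_finite: "D \<in> young \<Longrightarrow> finite D"
  unfolding young_def by blast

lemma diagram_of_young:
  assumes "h \<in> profile" shows "diagram_of h \<in> young"
proof (rule youngI)
  show "finite (diagram_of h)" by (rule finite_diagram_of[OF assms])
  show "1 \<le> i \<and> 1 \<le> j" if "(i, j) \<in> diagram_of h" for i j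
    using that by (simp add: diagram_of_def)
  show "(i', j') \<in> diagram_of h"
    if "(i, j) \<in> diagram_of h" "1 \<le> i'" "i' \<le> i" "1 \<le> j'" "j' \<le> j" for i j i' j'
    using that profileD[OF assms, of "j' - 1" "j - 1"] diff_le_mono[of j' j 1]
    by (simp add: diagram_of_def)
qed

text \<open>A column of a Young diagram, its diagonal, and an arm or a leg measured from the diagonal are all
downward closed sets above some \<open>a\<close>, so each is determined by its cardinality. The offset
\<open>a\<close> is \<open>0\<close> for columns and the diagonal, and the diagonal index for arms and legs.\<close>

lemma initial_segment_eq:
  fixes S :: "nat set"
  assumes "finite S" "\<And>i. i \<in> S \<Longrightarrow> a < i" "\<And>i i'. i \<in> S \<Longrightarrow> a < i' \<Longrightarrow> i' \<le> i \<Longrightarrow> i' \<in> S"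
  shows "S = {a<..a + card S}"
proof (cases "S = {}")
  case False
  have "S = {a<..Max S}"
  proof (intro equalityI subsetI)
    show "i \<in> {a<..Max S}" if "i \<in> S" for i
      using assms(1) assms(2)[OF that] that by simp
    show "i \<in> S" if "i \<in> {a<..Max S}" for i
      using assms(3)[OF Max_in[OF assms(1) False], of i] that by simp
  qed
  then have "card S = Max S - a" by (metis card_greaterThanAtMost)
  moreover have "a < Max S" using assms False Max_in by blast
  ultimately show ?thesis using \<open>S = {a<..Max S}\<close> by simp
qed simp

lemma young_column:
  assumes "D \<in> young"
  shows "{i. (i, Suc j) \<in> D} = {1..heights D j}"
proof -
  have "finite ((\<lambda>i. (i, Suc j)) -` D)"
    by (rule finite_vimageI[OF young_finite[OF assms]]) (auto simp: inj_def)
  then have "finite {i. (i, Suc j) \<in> D}" by (simp add: vimage_def)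
  then have "{i. (i, Suc j) \<in> D} = {0<..0 + heights D j}"
    unfolding heights_def
  proof (rule initial_segment_eq)
    show "0 < i" if "i \<in> {i. (i, Suc j) \<in> D}" for i
      using young_posD[OF assms, of i "Suc j"] that by simp
    show "i' \<in> {i. (i, Suc j) \<in> D}" if "i \<in> {i. (i, Suc j) \<in> D}" "0 < i'" "i' \<le> i" for i i'
      using young_downD[OF assms, of i "Suc j" i' "Suc j"] that by simp
  qed
  then show ?thesis by (simp add: atLeastSucAtMost_greaterThanAtMost)
qed

lemma diagram_of_heights:
  assumes "D \<in> young" shows "diagram_of (heights D) = D"
proof -
  have "(i, j) \<in> diagram_of (heights D) \<longleftrightarrow> (i, j) \<in> D" for i j
  proof (cases j)
    case 0
    then show ?thesis using young_posD[OF assms, of i j] by (auto simp: diagram_of_def)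
  next
    case (Suc k)
    have "i \<in> {i. (i, Suc k) \<in> D} \<longleftrightarrow> i \<in> {1..heights D k}"
      by (simp only: young_column[OF assms])
    then show ?thesis by (simp add: diagram_of_def Suc)
  qed
  then show ?thesis by auto
qed

text \<open>Together with the preceding facts this identifies Young diagrams with profiles.\<close>

lemma heights_profile:
  assumes "D \<in> young" shows "heights D \<in> profile"
proof -
  have "heights D j \<le> heights D i" if "i \<le> j" for i j
  proof -
    have "{k. (k, Suc j) \<in> D} \<subseteq> {k. (k, Suc i) \<in> D}"
    proof safe
      fix k assume "(k, Suc j) \<in> D"
      then show "(k, Suc i) \<in> D"
        using young_downD[OF assms, of k "Suc j" k "Suc i"] young_posD[OF assms] that by simp
    qed
    then show ?thesis unfolding young_column[OF assms] by auto
  qed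
  moreover have "heights D (Max (insert 0 (snd ` D))) = 0"
  proof -
    have "j \<le> Max (insert 0 (snd ` D))" if "(i, j) \<in> D" for i j
      using young_finite[OF assms] that by (intro Max_ge) force+
    then have "{k. (k, Suc (Max (insert 0 (snd ` D)))) \<in> D} = {}"
      using not_less_eq_eq by blast
    then show ?thesis unfolding heights_def by (metis card.empty)
  qed
  ultimately show ?thesis by (auto simp: profile_def antimono_def)
qed

section \<open>Stripping and adding one hook\<close>

text \<open>Removing the rim cells in the last \<open>c + 1\<close> columns deletes the first of these columns and shortens
the other \<open>c\<close> by one: what remains of a column ends one row above the
end of its right neighbour, or is empty if that neighbour is.
The hook removed has \<open>v + c\<close> cells, where \<open>v\<close> is the height of the deleted column.\<close>

definition strip :: "nat \<Rightarrow> (nat \<Rightarrow> nat) \<Rightarrow> nat \<Rightarrow> nat" where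
  "strip c h j = (if j + c + 1 < width h then h j else h (j + 1) - 1)"

text \<open>The inverse of stripping. The column of height \<open>v\<close> has to be inserted at the index \<open>t\<close> of the
first column lower than \<open>v\<close>: the following \<open>c\<close> columns grow by one and must not exceed \<open>v\<close>.\<close>

definition add_hook :: "nat \<Rightarrow> nat \<Rightarrow> (nat \<Rightarrow> nat) \<Rightarrow> nat \<Rightarrow> nat" where
  "add_hook c v h j =
     (let t = conjugate h (v - 1) in
      if j < t then h j else if j = t then v else if j \<le> t + c then h (j - 1) + 1 else 0)"

lemma num_cols_diagram_of:
  assumes "h \<in> profile"
  shows "num_cols (diagram_of h) = width h"
proof -
  have cell: "(i, j) \<in> diagram_of h \<Longrightarrow> j \<le> width h" for i j
    using zero_iff_width_le[OF assms, of "j - 1"] by (auto simp: diagram_of_def)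
  have fin: "finite (insert 0 (snd ` diagram_of h))" using finite_diagram_of[OF assms] by simp
  show ?thesis
  proof (cases "width h = 0")
    case True
    then have "diagram_of h = {}" using cell by (force simp: diagram_of_def)
    then show ?thesis using True by (simp add: num_cols_def)
  next
    case False
    then have "h (width h - 1) \<noteq> 0" using zero_iff_width_le[OF assms, of "width h - 1"] by simp
    then have "(1, width h) \<in> diagram_of h" using False by (auto simp: diagram_of_def)
    then have "width h \<in> insert 0 (snd ` diagram_of h)" by force
    then show ?thesis unfolding num_cols_def
      using cell by (intro Max_eqI fin) auto
  qed
qed

lemma strip_hook_diagram_of:
  assumes "h \<in> profile"
  shows "strip_hook (c + 1) (diagram_of h) = diagram_of (strip c h)"
proof -
  have "(i, j) \<in> strip_hook (c + 1) (diagram_of h) \<longleftrightarrow> (i, j) \<in> diagram_of (strip c h)" for i j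
  proof (cases j)
    case 0 then show ?thesis by (auto simp: strip_hook_def diagram_of_def)
  next
    case (Suc k)
    then show ?thesis using profileD[OF assms, of k "Suc k"]
      unfolding strip_hook_def num_cols_diagram_of[OF assms]
      by (auto simp: rim_def strip_def diagram_of_def)
  qed
  then show ?thesis by auto
qed

text \<open>Only \<open>c\<close> columns are raised by \<^const>\<open>add_hook\<close>, so the insertion makes sense when no
nonempty column lies beyond them.\<close>

definition addable :: "nat \<Rightarrow> nat \<Rightarrow> (nat \<Rightarrow> nat) \<Rightarrow> bool" where
  "addable c v h \<longleftrightarrow> h \<in> profile \<and> 1 \<le> v \<and> h (conjugate h (v - 1) + c) = 0"

lemma add_hook:
  assumes "addable c v h"
  defines "t \<equiv> conjugate h (v - 1)"
  defines "g \<equiv> add_hook c v h"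
  shows "g \<in> profile" "width g = t + c + 1" "g t = v" "strip c g = h"
    "weight g = weight h + (v + c)" "h 0 \<le> m \<Longrightarrow> v \<le> m \<Longrightarrow> g 0 \<le> m"
proof -
  have h: "h \<in> profile" and v: "1 \<le> v" and z: "h (t + c) = 0"
    using assms by (auto simp: addable_def)
  have g: "g j = (if j < t then h j else if j = t then v else if j \<le> t + c then h (j - 1) + 1 else 0)" for j
    by (simp add: g_def add_hook_def t_def)
  have t: "j < t \<longleftrightarrow> v \<le> h j" for j
    using less_conjugate_iff[OF h, of j "v - 1"] v by (auto simp: t_def)
  have "g (Suc j) \<le> g j" for j
    unfolding g using t[of j] t[of t] profileD[OF h, of j "Suc j"] profileD[OF h, of "j-1" j]
    by auto
  then have "antimono g" by (simp add: antimono_iff_le_Suc)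
  moreover have g0: "g j = 0 \<longleftrightarrow> t + c + 1 \<le> j" for j
    unfolding g using t[of j] v by auto
  ultimately show p: "g \<in> profile" by (auto simp: profile_def)
  show w: "width g = t + c + 1"
    using g0 zero_iff_width_le[OF p] by (meson dual_order.antisym order_refl)
  show "g t = v" by (simp add: g)
  show "strip c g = h"
  proof
    fix j show "strip c g j = h j"
      using profileD[OF h, of "t + c" j] z unfolding strip_def w g by auto
  qed
  have "weight g = (\<Sum>j<t + Suc c. g j)" by (simp add: weight_def w)
  also have "\<dots> = (\<Sum>j<t. g j) + (\<Sum>j=t..<t + Suc c. g j)"
    by (simp add: lessThan_atLeast0 sum.atLeastLessThan_concat)
  also have "(\<Sum>j=t..<t + Suc c. g j) = g t + (\<Sum>j=t..<t+c. g (Suc j))"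
    by (simp only: sum.atLeast_Suc_lessThan add_Suc_right sum.shift_bounds_Suc_ivl)
  also have "(\<Sum>j=t..<t+c. g (Suc j)) = (\<Sum>j=t..<t+c. h j + 1)"
    by (rule sum.cong) (auto simp: g)
  also have "\<dots> = (\<Sum>j=t..<t+c. h j) + c" by (simp only: sum.distrib) simp
  also have "(\<Sum>j<t. g j) = (\<Sum>j<t. h j)" by (rule sum.cong) (auto simp: g)
  finally have "weight g = (\<Sum>j<t. h j) + (\<Sum>j=t..<t+c. h j) + (v + c)"
    by (simp add: \<open>g t = v\<close>)
  also have "(\<Sum>j<t. h j) + (\<Sum>j=t..<t+c. h j) = (\<Sum>j<t+c. h j)"
    by (simp add: lessThan_atLeast0 sum.atLeastLessThan_concat)
  also have "\<dots> = weight h" using weight_eq_sum[OF h z] by simp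
  finally show "weight g = weight h + (v + c)" .
  show "g 0 \<le> m" if "h 0 \<le> m" "v \<le> m" using that by (auto simp: g)
qed

text \<open>Insertion puts the deleted column back where it was: the columns to its left are at least as high,
and those to its right, being shortened, are strictly lower.\<close>

lemma add_hook_strip:
  assumes h: "h \<in> profile" and w: "c < width h"
  defines "t \<equiv> width h - (c + 1)"
  shows "addable c (h t) (strip c h)" "add_hook c (h t) (strip c h) = h"
    "strip c h 0 \<le> h 0"
proof -
  define g where "g = strip c h"
  have g: "g j = (if j < t then h j else h (j + 1) - 1)" for j
    using w by (auto simp: g_def strip_def t_def)
  have z: "h j = 0 \<longleftrightarrow> t + c + 1 \<le> j" for j
    using zero_iff_width_le[OF h, of j] w by (simp add: t_def)
  have pos: "h t > 0" using z[of t] by simp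
  have "g (Suc j) \<le> g j" for j
    unfolding g using profileD[OF h, of j "Suc j"] profileD[OF h, of "Suc j" "Suc (Suc j)"] by auto
  then have p: "g \<in> profile"
    using z[of "t + c + 1"] g[of "t + c"] by (auto simp: profile_def antimono_iff_le_Suc)
  have "conjugate g (h t - 1) \<le> j \<longleftrightarrow> t \<le> j" for j
    unfolding conjugate_le_iff[OF p]
    using profileD[OF h, of j t] profileD[OF h, of t "Suc j"] pos by (auto simp: g)
  then have t: "conjugate g (h t - 1) = t" by (meson dual_order.antisym order_refl)
  show "addable c (h t) (strip c h)"
    using p pos z[of "t + c + 1"] unfolding addable_def g_def[symmetric] t by (simp add: g)
  show "add_hook c (h t) (strip c h) = h"
  proof
    fix j
    show "add_hook c (h t) (strip c h) j = h j"
      unfolding add_hook_def g_def[symmetric] t Let_def g using z[of j] by auto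
  qed
  show "strip c h 0 \<le> h 0" unfolding g_def[symmetric] g using profileD[OF h, of 0 1] by auto
qed

section \<open>Diagrams as residual diagram and hooks\<close>

text \<open>The heights \<open>vs\<close> are listed in the order in which stripping meets them: the head belongs to the hook
that is stripped first, hence added last.\<close>

definition build :: "nat \<Rightarrow> (nat \<Rightarrow> nat) \<Rightarrow> nat list \<Rightarrow> nat \<Rightarrow> nat" where
  "build c R vs = foldr (add_hook c) vs R"

lemma build_simps [simp]: "build c R [] = R" "build c R (v # vs) = add_hook c v (build c R vs)"
  by (simp_all add: build_def)

text \<open>Why a weakly increasing list of heights is always legitimate: if the hook of height \<open>u\<close> was added last,
its column stands exactly \<open>c + 1\<close> places before the right end, so at most \<open>c\<close> nonempty columns are lower than
\<open>v \<le> u\<close>. For the initial diagram the same bound holds because it has at most \<open>c\<close> columns.\<close>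

lemma build_addable:
  assumes "R \<in> profile" "R c = 0"
  shows "sorted vs \<Longrightarrow> \<forall>v\<in>set vs. 1 \<le> v \<Longrightarrow> 1 \<le> v \<Longrightarrow> \<forall>u\<in>set vs. v \<le> u \<Longrightarrow> addable c v (build c R vs)"
proof (induction vs arbitrary: v)
  case Nil
  then show ?case using assms profileD[OF assms(1), of c "conjugate R (v - 1) + c"]
    by (simp add: addable_def)
next
  case (Cons u vs)
  let ?E = "build c R vs"
  have a: "addable c u ?E" using Cons by auto
  define t where "t = conjugate ?E (u - 1)"
  let ?g = "add_hook c u ?E"
  note g = add_hook[OF a, folded t_def]
  have "t < conjugate ?g (v - 1)"
    unfolding less_conjugate_iff[OF g(1)] g(3) using Cons.prems by auto
  then have "?g (conjugate ?g (v - 1) + c) = 0"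
    unfolding zero_iff_width_le[OF g(1)] g(2) by simp
  then show ?case using g(1) Cons.prems by (simp add: addable_def)
qed

lemma build_profile:
  assumes "R \<in> profile" "R c = 0" "sorted vs" "\<forall>v\<in>set vs. 1 \<le> v"
  shows "build c R vs \<in> profile" "weight (build c R vs) = weight R + (\<Sum>v\<leftarrow>vs. v + c)"
    "R 0 \<le> m \<Longrightarrow> \<forall>v\<in>set vs. v \<le> m \<Longrightarrow> build c R vs 0 \<le> m"
    "strip_all (c + 1) (diagram_of (build c R vs)) = diagram_of R"
  using assms(3-)
proof (induction vs)
  case Nil
  { case 1 show ?case using assms by simp }
  { case 2 show ?case by simp }
  { case 3 then show ?case by simp }
  { case 4 have "width R \<le> c" using zero_iff_width_le assms by blast
    then show ?case unfolding strip_all_def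
      by (subst while_unfold) (simp add: num_cols_diagram_of assms) }
next
  case (Cons v vs)
  { assume "sorted (v # vs)" "\<forall>v\<in>set (v # vs). 1 \<le> v"
    then have "addable c v (build c R vs)" by (intro build_addable assms) auto
  } note a = this
  { case 1 then show ?case using add_hook[OF a] by simp }
  { case 2 then show ?case using add_hook[OF a] Cons by simp }
  { case 3 then show ?case using add_hook[OF a] Cons by simp }
  { case 4
    note g = add_hook[OF a[OF 4]]
    have "strip_all (c + 1) (diagram_of (build c R (v # vs)))
       = strip_all (c + 1) (strip_hook (c + 1) (diagram_of (add_hook c v (build c R vs))))"
      unfolding strip_all_def
      by (subst while_unfold) (simp only: num_cols_diagram_of[OF g(1)] g(2) build_simps, simp)
    then show ?case using Cons 4 by (simp only: strip_hook_diagram_of[OF g(1)] g(4)) simp }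
qed

lemma build_Cons_neq:
  assumes "R \<in> profile" "R c = 0" "sorted (v # vs)" "\<forall>u\<in>set (v # vs). 1 \<le> u"
  shows "build c R (v # vs) \<noteq> R"
proof -
  have "addable c v (build c R vs)" using assms by (intro build_addable) auto
  then have "c < width (build c R (v # vs))" by (simp add: add_hook(2))
  then show ?thesis using zero_iff_width_le[OF assms(1)] assms(2) by auto
qed

text \<open>The height of the last added hook can be read off \<open>c + 1\<close> places before the right end, and stripping
recovers the diagram before that addition.\<close>

lemma build_inj:
  assumes "R \<in> profile" "R c = 0"
  shows "sorted vs \<Longrightarrow> \<forall>v\<in>set vs. 1 \<le> v \<Longrightarrow> sorted ws \<Longrightarrow> \<forall>v\<in>set ws. 1 \<le> v \<Longrightarrow>
     build c R vs = build c R ws \<Longrightarrow> vs = ws"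
proof (induction vs arbitrary: ws)
  case Nil
  show ?case
  proof (cases ws)
    case (Cons w ws')
    then have "build c R (w # ws') \<noteq> R" using Nil.prems(3,4) by (intro build_Cons_neq assms) auto
    then show ?thesis using Nil.prems(5) Cons by (metis build_simps(1))
  qed simp
next
  case (Cons v vs)
  have a: "addable c v (build c R vs)" using Cons.prems(1,2) by (intro build_addable assms) auto
  show ?case
  proof (cases ws)
    case Nil
    have "build c R (v # vs) \<noteq> R" using Cons.prems(1,2) by (intro build_Cons_neq assms) auto
    then show ?thesis using Cons.prems(5) Nil by (metis build_simps(1))
  next
    case (Cons w ws')
    have b: "addable c w (build c R ws')" using Cons.prems(3,4) Cons by (intro build_addable assms) auto
    have eq: "add_hook c v (build c R vs) = add_hook c w (build c R ws')"
      using Cons.prems(5) Cons by simp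
    have rest: "build c R vs = build c R ws'"
      by (rule trans[OF add_hook(4)[OF a, symmetric]], subst eq, rule add_hook(4)[OF b])
    then have "vs = ws'"
    proof -
      have "sorted vs" "\<forall>v\<in>set vs. 1 \<le> v" "sorted ws'" "\<forall>v\<in>set ws'. 1 \<le> v"
        using Cons.prems(1-4) Cons by simp_all
      then show ?thesis using rest by (rule Cons.IH)
    qed
    have "conjugate (build c R vs) (v - 1) + c + 1 = conjugate (build c R ws') (w - 1) + c + 1"
      by (rule trans[OF add_hook(2)[OF a, symmetric]], subst eq, rule add_hook(2)[OF b])
    then have "conjugate (build c R vs) (v - 1) = conjugate (build c R ws') (w - 1)" by simp
    then have "v = w" using add_hook(3)[OF a] add_hook(3)[OF b] by (metis eq)
    then show ?thesis using Cons \<open>vs = ws'\<close> by simp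
  qed
qed

text \<open>Conversely, stripping a diagram repeatedly yields the heights in weakly increasing order. A strip
deletes the column at index \<open>t\<close>, after which at most \<open>t + c\<close> columns remain; the next deleted column
therefore lies to the left of \<open>t\<close>, where nothing has changed, and is at least as high. Thus diagrams
with at most \<open>m\<close> rows correspond to a residual diagram with at most \<open>c\<close> columns and a multiset of
heights in \<open>{1..m}\<close>.\<close>

lemma build_surj:
  assumes "h \<in> profile" "h 0 \<le> m"
  shows "\<exists>R vs. R \<in> profile \<and> R c = 0 \<and> R 0 \<le> m \<and> sorted vs \<and> set vs \<subseteq> {1..m} \<and> h = build c R vs"
  using assms
proof (induction "weight h" arbitrary: h rule: less_induct)
  case less
  show ?case
  proof (cases "c < width h")
    case False
    then have "h c = 0" using zero_iff_width_le[OF less(2)] by simp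
    then show ?thesis using less by (intro exI[of _ h] exI[of _ "[]"]) auto
  next
    case True
    define t where "t = width h - (c + 1)"
    define g where "g = strip c h"
    note s = add_hook_strip[OF less(2) True, folded t_def g_def]
    have g: "g \<in> profile" "1 \<le> h t" using s(1) by (auto simp: addable_def)
    have "weight h = weight g + (h t + c)" using add_hook(5)[OF s(1)] s(2) by simp
    then obtain R vs where R: "R \<in> profile" "R c = 0" "R 0 \<le> m" "sorted vs" "set vs \<subseteq> {1..m}"
      "g = build c R vs"
      using less(1)[of g] g s(3) less(3) by auto
    have "h t \<le> m" using profileD[OF less(2), of 0 t] less(3) by simp
    moreover have "sorted (h t # vs)"
    proof (cases vs)
      case (Cons u us)
      have b: "addable c u (build c R us)"
        using R Cons by (intro build_addable) auto
      define k where "k = conjugate (build c R us) (u - 1)"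
      have wg: "width g = k + c + 1" "g k = u"
        using add_hook[OF b] by (simp_all add: R(6) Cons k_def)
      have "g (t + c) = 0"
        using zero_iff_width_le[OF less(2), of "t + c + 1"] True
        by (auto simp: g_def strip_def t_def)
      then have "k < t" using zero_iff_width_le[OF g(1), of "t + c"] wg by simp
      then have "g k = h k" by (auto simp: g_def strip_def t_def)
      then have "h t \<le> u" using profileD[OF less(2), of k t] \<open>k < t\<close> wg by simp
      then show ?thesis using R(4) Cons by auto
    qed simp
    ultimately show ?thesis using R g(2) s(2)
      by (intro exI[of _ R] exI[of _ "h t # vs"]) auto
  qed
qed

section \<open>Frobenius coordinates\<close>

text \<open>Frobenius coordinates, indexed by \<open>1..d\<close>. They are integers because they will be shifted in both
directions.\<close>

definition frob_seqs :: "nat \<Rightarrow> (nat \<Rightarrow> int) \<Rightarrow> (nat \<Rightarrow> int) \<Rightarrow> bool" where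
  "frob_seqs d x y \<longleftrightarrow> (\<forall>i. 1 \<le> i \<and> i \<le> d \<longrightarrow> 0 \<le> x i \<and> 0 \<le> y i) \<and>
     (\<forall>i. 1 \<le> i \<and> i < d \<longrightarrow> x (i + 1) < x i \<and> y (i + 1) < y i)"

definition from_frob :: "nat \<Rightarrow> (nat \<Rightarrow> int) \<Rightarrow> (nat \<Rightarrow> int) \<Rightarrow> diagram" where
  "from_frob d x y = {(p, q). 1 \<le> p \<and> 1 \<le> q \<and>
     (if p \<le> q then p \<le> d \<and> int q \<le> int p + x p else q \<le> d \<and> int p \<le> int q + y q)}"

text \<open>The coordinates of a diagram, extended by the boundary values \<open>x\<^bsub>d+1\<^esub> = - 1\<close> and \<open>y\<^sub>0 = m\<close> that
enter the definition of the rank.\<close>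

definition arm_seq :: "diagram \<Rightarrow> nat \<Rightarrow> int" where
  "arm_seq D i = (if i = diag_len D + 1 then - 1 else int (frob_arm D i))"

definition leg_seq :: "int \<Rightarrow> diagram \<Rightarrow> nat \<Rightarrow> int" where
  "leg_seq m D i = (if i = 0 then m else int (frob_leg D i))"

lemma frob_seqs_antimono:
  assumes "frob_seqs d x y" "1 \<le> i" "i \<le> j" "j \<le> d"
  shows "int j + x j \<le> int i + x i" "int j + y j \<le> int i + y i"
proof -
  have "int j + x j \<le> int i + x i \<and> int j + y j \<le> int i + y i"
    using assms(3,4)
  proof (induction rule: dec_induct)
    case (step n)
    then have "x (n + 1) < x n \<and> y (n + 1) < y n" using assms(1,2) by (simp add: frob_seqs_def)
    then show ?case using step by simp
  qed simp
  then show "int j + x j \<le> int i + x i" "int j + y j \<le> int i + y i" by simp_all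
qed

lemma frob_seqs_nonneg:
  assumes "frob_seqs d x y" "1 \<le> i" "i \<le> d"
  shows "0 \<le> x i" "0 \<le> y i"
  using assms by (auto simp: frob_seqs_def)

text \<open>All hooks are contained in the rectangle spanned by the first one, because \<open>i + x i\<close> and \<open>i + y i\<close>
weakly decrease.\<close>

lemma from_frob_cell_bounds:
  assumes "frob_seqs d x y" "(p, q) \<in> from_frob d x y"
  shows "1 \<le> d" "int p \<le> 1 + y 1" "int q \<le> 1 + x 1"
  using assms(2) frob_seqs_antimono[OF assms(1), of 1 p] frob_seqs_antimono[OF assms(1), of 1 q]
    frob_seqs_nonneg[OF assms(1), of p] frob_seqs_nonneg[OF assms(1), of q]
  by (auto simp: from_frob_def split: if_splits)

lemma from_frob_young:
  assumes "frob_seqs d x y"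
  shows "from_frob d x y \<in> young"
proof (rule youngI)
  have "from_frob d x y \<subseteq> {..nat (1 + y 1)} \<times> {..nat (1 + x 1)}"
  proof clarify
    fix p q assume "(p, q) \<in> from_frob d x y"
    note from_frob_cell_bounds[OF assms this]
    then show "p \<in> {..nat (1 + y 1)} \<and> q \<in> {..nat (1 + x 1)}"
      using nat_mono[of "int p" "1 + y 1"] nat_mono[of "int q" "1 + x 1"] by simp
  qed
  then show "finite (from_frob d x y)" using finite_subset by blast
  show "1 \<le> p \<and> 1 \<le> q" if "(p, q) \<in> from_frob d x y" for p q
    using that by (simp add: from_frob_def)
  show "(p', q') \<in> from_frob d x y"
    if "(p, q) \<in> from_frob d x y" and p': "1 \<le> p'" "p' \<le> p" and q': "1 \<le> q'" "q' \<le> q" for p q p' q'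
  proof (cases "p \<le> q")
    case True
    then have c: "p \<le> d" "int q \<le> int p + x p" using that(1) by (auto simp: from_frob_def)
    show ?thesis
    proof (cases "p' \<le> q'")
      case True
      then show ?thesis using frob_seqs_antimono(1)[OF assms p' c(1)] c p' q' by (simp add: from_frob_def)
    next
      case False
      then show ?thesis
        using frob_seqs_antimono(2)[OF assms q'(1), of p] frob_seqs_nonneg(2)[OF assms, of p] c p' q'
        by (simp add: from_frob_def)
    qed
  next
    case False
    then have c: "q \<le> d" "int p \<le> int q + y q" using that(1) by (auto simp: from_frob_def)
    show ?thesis
    proof (cases "p' \<le> q'")
      case True
      then show ?thesis
        using frob_seqs_antimono(1)[OF assms p'(1), of q] frob_seqs_nonneg(1)[OF assms, of q] c p' q'
        by (simp add: from_frob_def)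
    next
      case False
      then show ?thesis using frob_seqs_antimono(2)[OF assms q' c(1)] c p' q' by (simp add: from_frob_def)
    qed
  qed
qed

lemma from_frob_coords:
  assumes "frob_seqs d x y"
  shows "diag_len (from_frob d x y) = d"
    "1 \<le> i \<Longrightarrow> i \<le> d \<Longrightarrow> int (frob_arm (from_frob d x y) i) = x i"
    "1 \<le> i \<Longrightarrow> i \<le> d \<Longrightarrow> int (frob_leg (from_frob d x y) i) = y i"
proof -
  have "{i. (i, i) \<in> from_frob d x y} = {1..d}"
    using frob_seqs_nonneg[OF assms] by (auto simp: from_frob_def)
  then show "diag_len (from_frob d x y) = d" by (simp add: diag_len_def)
  assume i: "1 \<le> i" "i \<le> d"
  have "{j. i < j \<and> (i, j) \<in> from_frob d x y} = {i<..i + nat (x i)}"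
    using i frob_seqs_nonneg[OF assms, of i] by (auto simp: from_frob_def)
  then show "int (frob_arm (from_frob d x y) i) = x i"
    using frob_seqs_nonneg[OF assms i] by (simp add: frob_arm_def)
  have "{j. i < j \<and> (j, i) \<in> from_frob d x y} = {i<..i + nat (y i)}"
    using i frob_seqs_nonneg[OF assms, of i] by (auto simp: from_frob_def)
  then show "int (frob_leg (from_frob d x y) i) = y i"
    using frob_seqs_nonneg[OF assms i] by (simp add: frob_leg_def)
qed

lemma card_from_frob:
  assumes "frob_seqs d x y"
  shows "int (card (from_frob d x y)) = (\<Sum>i=1..d. x i + y i + 1)"
proof -
  let ?arm = "\<lambda>i. Pair i ` {i..i + nat (x i)}"
  let ?leg = "\<lambda>i. (\<lambda>p. (p, i)) ` {i<..i + nat (y i)}"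
  have hook: "int (card (?arm i \<union> ?leg i)) = x i + y i + 1" if "i \<in> {1..d}" for i
  proof -
    have "card (?arm i \<union> ?leg i) = card (?arm i) + card (?leg i)"
      by (intro card_Un_disjoint) auto
    also have "card (?arm i) = nat (x i) + 1" by (simp add: card_image inj_on_def)
    also have "card (?leg i) = nat (y i)" by (simp add: card_image inj_on_def)
    finally show ?thesis using frob_seqs_nonneg[OF assms] that by simp
  qed
  have "(p, q) \<in> from_frob d x y \<longleftrightarrow> (\<exists>i\<in>{1..d}. (p, q) \<in> ?arm i \<union> ?leg i)" for p q
  proof (cases "p \<le> q")
    case True then show ?thesis
      using frob_seqs_nonneg[OF assms, of p] by (auto simp: from_frob_def image_iff)
  next
    case False then show ?thesis
      using frob_seqs_nonneg[OF assms, of q]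
      by (auto simp: from_frob_def image_iff intro!: bexI[of _ q])
  qed
  then have "from_frob d x y = (\<Union>i\<in>{1..d}. ?arm i \<union> ?leg i)" by (simp add: set_eq_iff)
  moreover have "card \<dots> = (\<Sum>i=1..d. card (?arm i \<union> ?leg i))"
    by (intro card_UN_disjoint) auto
  ultimately show ?thesis using hook by simp
qed

lemma diagonal_iff: "D \<in> young \<Longrightarrow> (i, i) \<in> D \<longleftrightarrow> 1 \<le> i \<and> i \<le> diag_len D"
proof -
  assume D: "D \<in> young"
  have "finite ((\<lambda>i. (i, i)) -` D)"
    by (rule finite_vimageI[OF young_finite[OF D]]) (auto simp: inj_def)
  then have "finite {i. (i, i) \<in> D}" by (simp add: vimage_def)
  then have "{i. (i, i) \<in> D} = {0<..0 + diag_len D}"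
    unfolding diag_len_def
  proof (rule initial_segment_eq)
    show "0 < i" if "i \<in> {i. (i, i) \<in> D}" for i using young_posD[OF D, of i i] that by simp
    show "i' \<in> {i. (i, i) \<in> D}" if "i \<in> {i. (i, i) \<in> D}" "0 < i'" "i' \<le> i" for i i'
      using young_downD[OF D, of i i i' i'] that by simp
  qed
  then show ?thesis by (auto simp: set_eq_iff Suc_le_eq)
qed

lemma arm_iff:
  assumes D: "D \<in> young" and "1 \<le> i" "i < j"
  shows "(i, j) \<in> D \<longleftrightarrow> j \<le> i + frob_arm D i"
proof -
  have "{j. i < j \<and> (i, j) \<in> D} \<subseteq> snd ` D" by force
  then have "finite {j. i < j \<and> (i, j) \<in> D}"
    using young_finite[OF D] finite_subset by blast
  then have "{j. i < j \<and> (i, j) \<in> D} = {i<..i + frob_arm D i}"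
    unfolding frob_arm_def
  proof (rule initial_segment_eq)
    show "i < j" if "j \<in> {j. i < j \<and> (i, j) \<in> D}" for j using that by simp
    show "j' \<in> {j. i < j \<and> (i, j) \<in> D}" if "j \<in> {j. i < j \<and> (i, j) \<in> D}" "i < j'" "j' \<le> j" for j j'
      using young_downD[OF D, of i j i j'] that assms(2) by simp
  qed
  then show ?thesis using assms by (auto simp: set_eq_iff)
qed

lemma leg_iff:
  assumes D: "D \<in> young" and "1 \<le> i" "i < j"
  shows "(j, i) \<in> D \<longleftrightarrow> j \<le> i + frob_leg D i"
proof -
  have "{j. i < j \<and> (j, i) \<in> D} \<subseteq> fst ` D" by force
  then have "finite {j. i < j \<and> (j, i) \<in> D}"
    using young_finite[OF D] finite_subset by blast
  then have "{j. i < j \<and> (j, i) \<in> D} = {i<..i + frob_leg D i}"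
    unfolding frob_leg_def
  proof (rule initial_segment_eq)
    show "i < j" if "j \<in> {j. i < j \<and> (j, i) \<in> D}" for j using that by simp
    show "j' \<in> {j. i < j \<and> (j, i) \<in> D}" if "j \<in> {j. i < j \<and> (j, i) \<in> D}" "i < j'" "j' \<le> j" for j j'
      using young_downD[OF D, of j i j' i] that assms(2) by simp
  qed
  then show ?thesis using assms by (auto simp: set_eq_iff)
qed

lemma frob_coords_decreasing:
  assumes D: "D \<in> young" and i: "1 \<le> i" "i < diag_len D"
  shows "frob_arm D (i + 1) < frob_arm D i" "frob_leg D (i + 1) < frob_leg D i"
proof -
  have d: "(i + 1, i + 1) \<in> D" using diagonal_iff[OF D] i by simp
  have "(i + 1, i + 1 + frob_arm D (i + 1)) \<in> D"
    using arm_iff[OF D, of "i + 1" "i + 1 + frob_arm D (i + 1)"] d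
    by (cases "frob_arm D (i + 1) = 0") auto
  then have "(i, i + 1 + frob_arm D (i + 1)) \<in> D"
    by (rule young_downD[OF D]) (use i in auto)
  then show "frob_arm D (i + 1) < frob_arm D i"
    using arm_iff[OF D i(1), of "i + 1 + frob_arm D (i + 1)"] by simp
  have "(i + 1 + frob_leg D (i + 1), i + 1) \<in> D"
    using leg_iff[OF D, of "i + 1" "i + 1 + frob_leg D (i + 1)"] d
    by (cases "frob_leg D (i + 1) = 0") auto
  then have "(i + 1 + frob_leg D (i + 1), i) \<in> D"
    by (rule young_downD[OF D]) (use i in auto)
  then show "frob_leg D (i + 1) < frob_leg D i"
    using leg_iff[OF D i(1), of "i + 1 + frob_leg D (i + 1)"] by simp
qed

lemma from_frob_cong:
  assumes "\<And>i. 1 \<le> i \<Longrightarrow> i \<le> d \<Longrightarrow> x i = x' i" "\<And>i. 1 \<le> i \<Longrightarrow> i \<le> d \<Longrightarrow> y i = y' i"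
  shows "from_frob d x y = from_frob d x' y'"
  using assms by (auto simp: from_frob_def)

lemma frob_seqs_diagram:
  "D \<in> young \<Longrightarrow> frob_seqs (diag_len D) (arm_seq D) (leg_seq m D)"
  using frob_coords_decreasing[of D]
  by (auto simp: frob_seqs_def arm_seq_def leg_seq_def)

lemma from_frob_diagram:
  assumes D: "D \<in> young"
  shows "from_frob (diag_len D) (arm_seq D) (leg_seq m D) = D"
proof -
  have "(p, q) \<in> from_frob (diag_len D) (arm_seq D) (leg_seq m D) \<longleftrightarrow> (p, q) \<in> D" for p q
  proof (cases "1 \<le> p \<and> 1 \<le> q")
    case False
    then show ?thesis using young_posD[OF D, of p q] by (auto simp: from_frob_def)
  next
    case True
    have dp: "p \<le> diag_len D" if "(p, q) \<in> D" "p \<le> q"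
      using that True young_downD[OF D, of p q p p] diagonal_iff[OF D, of p] by simp
    have dq: "q \<le> diag_len D" if "(p, q) \<in> D" "q \<le> p"
      using that True young_downD[OF D, of p q q q] diagonal_iff[OF D, of q] by simp
    consider "p < q" | "p = q" | "q < p" by linarith
    then show ?thesis
      using dp dq True arm_iff[OF D, of p q] leg_iff[OF D, of q p] diagonal_iff[OF D, of p]
      by cases (auto simp: from_frob_def arm_seq_def leg_seq_def)
  qed
  then show ?thesis by auto
qed

section \<open>The tail swap\<close>

text \<open>Bounds are integers so that boxes of side \<open>m - r\<close> can be written without truncation.\<close>

definition box :: "int \<Rightarrow> int \<Rightarrow> diagram set" where
  "box m c = {D \<in> young. \<forall>(p, q) \<in> D. int p \<le> m \<and> int q \<le> c}"

definition gap :: "int \<Rightarrow> diagram \<Rightarrow> nat \<Rightarrow> int" where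
  "gap m D i = leg_seq m D i - arm_seq D (i + 1)"

definition exceeds :: "int \<Rightarrow> int \<Rightarrow> diagram \<Rightarrow> bool" where
  "exceeds m r D \<longleftrightarrow> (\<exists>i\<le>diag_len D. r < gap m D i)"

text \<open>A reflection: the rows \<open>(x\<^sub>1 + r, ..., x\<^sub>d + r)\<close> and \<open>(y\<^sub>1, ..., y\<^sub>d)\<close> exchange their tails behind the
first index \<open>k\<close> where the gap is greater than \<open>r\<close>, and then \<open>r\<close> is subtracted from what has become
the leg side.\<close>

definition tail_swap :: "int \<Rightarrow> int \<Rightarrow> diagram \<Rightarrow> diagram" where
  "tail_swap m r D = (let k = (LEAST i. r < gap m D i);
       x = arm_seq D; y = leg_seq m D in
     from_frob (diag_len D)
       (\<lambda>i. if i \<le> k then x i + r else y i) (\<lambda>i. if i \<le> k then y i - r else x i))"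

text \<open>For \<open>k > 0\<close>, minimality of \<open>k\<close> gives \<open>y\<^bsub>k-1\<^esub> \<le> x\<^sub>k + r\<close>, hence \<open>y\<^bsub>k+1\<^esub> < x\<^sub>k + r\<close>, and the gap at \<open>k\<close> gives
\<open>x\<^bsub>k+1\<^esub> < y\<^sub>k - r\<close>: these are exactly the inequalities that keep both new rows decreasing. Every arm
raised by \<open>r\<close> is paired with a leg lowered by \<open>r\<close>, so the number of cells is preserved. Before \<open>k\<close> the
new gaps are at most \<open>- r\<close>, and at \<open>k\<close> the new gap is \<open>y\<^sub>k - y\<^bsub>k+1\<^esub> - r > - r\<close>
(reading \<open>y\<^bsub>d+1\<^esub>\<close> as \<open>- 1\<close>); so the same index is found again with \<open>- r\<close> in place of \<open>r\<close>, and the reflection is undone. Allowing \<open>r\<close> of either sign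
makes this one lemma serve for the map and for its inverse. For \<open>k = 0\<close> the first leg \<open>y\<^sub>1 < m\<close> becomes
the first arm; the assumption \<open>m \<le> c + r\<close> keeps it inside the new box.\<close>

lemma tail_swap:
  assumes D: "D \<in> box m c" and m: "0 \<le> m" "m \<le> c + r" and ex: "exceeds m r D"
  defines "E \<equiv> tail_swap m r D"
  shows "r \<le> m" "E \<in> box (m - r) (c + r)" "card E = card D"
    "exceeds (m - r) (- r) E" "tail_swap (m - r) (- r) E = D"
proof -
  have Y: "D \<in> young" using D by (simp add: box_def)
  define d where "d = diag_len D"
  define x where "x = arm_seq D"
  define y where "y = leg_seq m D"
  define k where "k = (LEAST i. r < gap m D i)"
  define X where "X = (\<lambda>i. if i \<le> k then x i + r else y i)"
  define Y' where "Y' = (\<lambda>i. if i \<le> k then y i - r else x i)"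
  have E: "E = from_frob d X Y'"
    unfolding E_def tail_swap_def d_def x_def y_def k_def X_def Y'_def Let_def by (rule refl)
  have gap: "gap m D i = y i - x (i + 1)" for i by (simp add: gap_def x_def y_def)
  have fs: "frob_seqs d x y" unfolding d_def x_def y_def by (rule frob_seqs_diagram[OF Y])
  have nonneg: "0 \<le> x i" "0 \<le> y i" if "1 \<le> i" "i \<le> d" for i
    using frob_seqs_nonneg[OF fs that] by auto
  have y0: "y 0 = m" and xd: "x (d + 1) = -1"
    by (simp_all add: y_def leg_seq_def x_def d_def arm_seq_def)
  \<comment> \<open>The end cells of the first row and column translate the box into bounds on the coordinates.\<close>
  have diag: "(1, 1 + nat (x 1)) \<in> D" "(1 + nat (y 1), 1) \<in> D" if "1 \<le> d"
    using that nonneg[of 1] unfolding from_frob_diagram[OF Y, of m, folded d_def x_def y_def, symmetric]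
    by (auto simp: from_frob_def)
  have bounds: "x 1 < c" "y 1 < m" if "1 \<le> d"
    using diag[OF that] nonneg[of 1] D that by (auto simp: box_def)
  have x_dec: "x (i + 1) < x i" if "1 \<le> i" "i \<le> d" for i
    using that fs nonneg[of i] xd by (cases "i = d") (auto simp: frob_seqs_def)
  have y_dec: "y (i + 1) < y i" if "i < d" for i
    using that fs bounds y0 by (cases "i = 0") (auto simp: frob_seqs_def)
  obtain i where i: "i \<le> d" "r < gap m D i" using ex by (auto simp: exceeds_def d_def)
  have k: "r < y k - x (k + 1)" using LeastI[of "\<lambda>i. r < gap m D i", OF i(2)] by (simp add: k_def gap)
  have kd: "k \<le> d" using Least_le[of "\<lambda>i. r < gap m D i", OF i(2)] i(1) by (simp add: k_def)
  have least: "y j - x (j + 1) \<le> r" if "j < k" for j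
    using not_less_Least[of j "\<lambda>i. r < gap m D i"] that by (auto simp: k_def gap)
  \<comment> \<open>The next three facts cover \<open>k = d\<close> and \<open>k = 0\<close>, where \<open>x (k + 1)\<close> or \<open>y k\<close> is a boundary value.\<close>
  have x_ge: "-1 \<le> x (k + 1)" using xd nonneg[of "k + 1"] kd by (cases "k = d") auto
  have y_nonneg: "0 \<le> y j" if "j \<le> d" for j using that nonneg[of j] m(1) y0 by (cases j) auto
  have y_le: "y k \<le> m"
    using kd
  proof (induction k)
    case (Suc n) then show ?case using y_dec[of n] by simp
  qed (simp add: y0)
  show rm: "r \<le> m" using k x_ge y_le by simp
  have fs': "frob_seqs d X Y'"
    unfolding frob_seqs_def
  proof (intro conjI allI impI)
    fix i assume i: "1 \<le> i \<and> i \<le> d"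
    show "0 \<le> X i"
      using i nonneg[of i] least[of "i - 1"] y_nonneg[of "i - 1"] by (cases i) (auto simp: X_def)
    show "0 \<le> Y' i"
    proof (cases "i \<le> k")
      case True
      have "y k \<le> y i" using kd
        using frob_seqs_antimono(2)[OF fs, of i k] i True by linarith
      then show ?thesis using k x_ge True by (simp add: Y'_def)
    qed (use i nonneg in \<open>simp add: Y'_def\<close>)
  next
    fix i assume i: "1 \<le> i \<and> i < d"
    show "X (i + 1) < X i"
      using i x_dec[of i] y_dec[of i] y_dec[of "i - 1"] least[of "i - 1"]
      by (cases i) (auto simp: X_def)
    show "Y' (i + 1) < Y' i"
      using i x_dec[of i] y_dec[of i] k by (cases "i = k") (auto simp: Y'_def)
  qed
  have EY: "E \<in> young" unfolding E by (rule from_frob_young[OF fs'])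
  note coords = from_frob_coords[OF fs', folded E]
  show "E \<in> box (m - r) (c + r)"
  proof -
    have "int p \<le> m - r \<and> int q \<le> c + r" if "(p, q) \<in> E" for p q
    proof -
      note b = from_frob_cell_bounds[OF fs' that[unfolded E]]
      have "X 1 < c + r" "Y' 1 < m - r"
        using bounds[OF b(1)] m k y0 by (cases "k = 0"; simp add: X_def Y'_def)+
      then show ?thesis using b by simp
    qed
    then show ?thesis using EY by (auto simp: box_def)
  qed
  have "int (card E) = (\<Sum>i=1..d. X i + Y' i + 1)" unfolding E by (rule card_from_frob[OF fs'])
  also have "\<dots> = (\<Sum>i=1..d. x i + y i + 1)" by (rule sum.cong) (auto simp: X_def Y'_def)
  also have "\<dots> = int (card D)"
    using card_from_frob[OF fs] from_frob_diagram[OF Y, of m] by (simp add: d_def x_def y_def)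
  finally show "card E = card D" by simp
  have dE: "diag_len E = d" by (rule coords(1))
  have xE: "arm_seq E i = (if i = d + 1 then -1 else X i)" if "1 \<le> i" "i \<le> d + 1" for i
    using that coords(2)[of i] by (auto simp: arm_seq_def dE)
  have yE: "leg_seq (m - r) E i = (if i = 0 then m - r else Y' i)" if "i \<le> d" for i
    using that coords(3)[of i] by (auto simp: leg_seq_def)
  have gapE: "gap (m - r) E i = y i - r - (if i = d + 1 then -1 else x (i + 1) + r)" if "i < k" for i
    using that kd xE[of "i + 1"] yE[of i] by (auto simp: gap_def X_def Y'_def y0)
  have gapk: "- r < gap (m - r) E k"
    using kd xE[of "k + 1"] yE[of k] y_dec[of k] y_nonneg[of k]
    by (auto simp: gap_def X_def Y'_def y0)
  show "exceeds (m - r) (- r) E" using gapk kd by (auto simp: exceeds_def dE)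
  have kE: "(LEAST i. - r < gap (m - r) E i) = k"
  proof (rule Least_equality)
    show "k \<le> j" if "- r < gap (m - r) E j" for j
    proof (rule ccontr)
      assume "\<not> k \<le> j"
      then show False using gapE[of j] least[of j] that kd by (auto split: if_splits)
    qed
  qed (rule gapk)
  have "tail_swap (m - r) (- r) E = from_frob d x y"
    unfolding tail_swap_def kE dE Let_def
  proof (rule from_frob_cong)
    fix i assume i: "1 \<le> i" "i \<le> d"
    then show "(if i \<le> k then arm_seq E i + - r else leg_seq (m - r) E i) = x i"
      using xE[of i] yE[of i] by (simp add: X_def Y'_def)
    show "(if i \<le> k then leg_seq (m - r) E i - - r else arm_seq E i) = y i"
      using xE[of i] yE[of i] i by (simp add: X_def Y'_def)
  qed
  then show "tail_swap (m - r) (- r) E = D"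
    using from_frob_diagram[OF Y, of m] by (simp add: d_def x_def y_def)
qed

section \<open>The Durfee rectangle\<close>

text \<open>In a sorted list the zeros come last, so omitting them does not shift any other row.\<close>

lemma ferrers_filter_pos:
  "sorted_wrt (\<ge>) xs \<Longrightarrow> ferrers (filter (\<lambda>p. 0 < p) xs) = ferrers xs"
proof (induction xs rule: rev_induct)
  case (snoc x xs)
  show ?case
  proof (cases "x = 0")
    case True
    have "(i, j) \<in> ferrers (xs @ [0]) \<longleftrightarrow> (i, j) \<in> ferrers xs" for i j
      by (auto simp: ferrers_def nth_append)
    then have "ferrers (xs @ [0]) = ferrers xs" by auto
    then show ?thesis using snoc True by (simp add: sorted_wrt_append)
  next
    case False
    then have "\<forall>p\<in>set (xs @ [x]). 0 < p" using snoc.prems by (auto simp: sorted_wrt_append)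
    then show ?thesis by (metis filter_True)
  qed
qed simp

text \<open>The partition whose first \<open>m\<close> rows are the rectangle of width \<open>c\<close> with the diagram of column heights
\<open>h\<close> to its right, and whose remaining rows are \<open>b\<close>.\<close>

definition glue :: "nat \<Rightarrow> nat \<Rightarrow> (nat \<Rightarrow> nat) \<Rightarrow> nat list \<Rightarrow> nat list" where
  "glue m c h b = map (\<lambda>i. conjugate h i + c) [0..<m] @ b"

text \<open>The corner cell of the rectangle decides, since the rows above it are at least as long.\<close>

lemma durfee_rectangle_iff:
  assumes "sorted_wrt (\<ge>) l" "0 < k"
  shows "{1..k} \<times> {1..k + a} \<subseteq> ferrers l \<longleftrightarrow> k \<le> length l \<and> k + a \<le> l ! (k - 1)"
proof
  assume "{1..k} \<times> {1..k + a} \<subseteq> ferrers l"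
  moreover have "(k, k + a) \<in> {1..k} \<times> {1..k + a}" using assms(2) by simp
  ultimately have "(k, k + a) \<in> ferrers l" by blast
  then show "k \<le> length l \<and> k + a \<le> l ! (k - 1)" by (simp add: ferrers_def)
next
  assume k: "k \<le> length l \<and> k + a \<le> l ! (k - 1)"
  show "{1..k} \<times> {1..k + a} \<subseteq> ferrers l"
  proof clarify
    fix i j assume ij: "i \<in> {1..k}" "j \<in> {1..k + a}"
    have "l ! (k - 1) \<le> l ! (i - 1)"
    proof (cases "i = k")
      case False
      then show ?thesis using assms ij k by (intro sorted_wrt_nth_less[where P = "(\<ge>)"]) auto
    qed simp
    then show "(i, j) \<in> ferrers l" using ij k by (simp add: ferrers_def)
  qed
qed

lemma glue:
  assumes h: "h \<in> profile" "h 0 \<le> m"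
    and b: "sorted_wrt (\<ge>) b" "set b \<subseteq> {1..m + a}"
  defines "l \<equiv> glue m (m + a) h b"
  shows "l \<in> partitions_of (m * (m + a) + weight h + sum_list b)"
    "durfee a l = m" "ferrers (right_part a l) = diagram_of h"
proof -
  have conj: "conjugate h j \<le> conjugate h i" if "i \<le> j" for i j
    by (rule profileD[OF conjugate_profile[OF h(1)] that])
  have top: "sorted_wrt (\<ge>) (map (\<lambda>i. conjugate h i + k) [0..<m])" for k
    using conj by (auto simp: sorted_wrt_map intro!: sorted_wrt_mono_rel[OF _ sorted_wrt_upt])
  have sorted: "sorted_wrt (\<ge>) l"
    using top[of "m + a"] b by (auto simp: l_def glue_def sorted_wrt_append trans_le_add2)
  have zero: "conjugate h m = 0" using conjugate_le_iff[OF h(1), of m 0] h(2) by simp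
  have "(\<Sum>i\<leftarrow>[0..<m]. conjugate h i + (m + a)) = (\<Sum>i<m. conjugate h i + (m + a))"
    by (simp add: sum_list_distinct_conv_sum_set lessThan_atLeast0 del: sum_list_addf)
  also have "\<dots> = weight h + m * (m + a)"
    using weight_eq_sum[OF conjugate_profile[OF h(1)] zero] weight_conjugate[OF h(1)]
    by (simp add: sum.distrib)
  finally have "sum_list l = m * (m + a) + weight h + sum_list b"
    unfolding l_def glue_def by simp
  moreover have "\<forall>p\<in>set l. 0 < p" using b(2) by (auto simp: l_def glue_def)
  ultimately show "l \<in> partitions_of (m * (m + a) + weight h + sum_list b)"
    using sorted by (simp add: partitions_of_def)
  have len: "length l = m + length b" by (simp add: l_def glue_def)
  show durfee: "durfee a l = m"
    unfolding durfee_def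
  proof (rule Greatest_equality)
    show "{1..m} \<times> {1..m + a} \<subseteq> ferrers l"
    proof (cases "m = 0")
      case False
      then show ?thesis
        unfolding durfee_rectangle_iff[OF sorted False[unfolded neq0_conv]]
        by (simp add: l_def glue_def nth_append)
    qed simp
    fix k assume k: "{1..k} \<times> {1..k + a} \<subseteq> ferrers l"
    show "k \<le> m"
    proof (rule ccontr)
      assume "\<not> k \<le> m"
      then have "(m + 1, m + 1 + a) \<in> ferrers l" using k by auto
      then have "m < length l" "m + 1 + a \<le> l ! m" by (auto simp: ferrers_def)
      then have "b ! 0 \<in> set b" "m + 1 + a \<le> b ! 0"
        by (auto simp: len) (simp add: l_def glue_def nth_append)
      then show False using b(2) by auto
    qed
  qed
  have "right_part a l = filter (\<lambda>p. 0 < p) (map (conjugate h) [0..<m])"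
    unfolding right_part_def durfee by (simp add: l_def glue_def comp_def)
  then have "ferrers (right_part a l) = ferrers (map (conjugate h) [0..<m])"
    using ferrers_filter_pos top[of 0] by simp
  also have "\<dots> = diagram_of h"
  proof -
    have "(i, j) \<in> ferrers (map (conjugate h) [0..<m]) \<longleftrightarrow> (i, j) \<in> diagram_of h" for i j
      using less_conjugate_iff[OF h(1), of "j - 1" "i - 1"] profileD[OF h(1), of 0 "j - 1"] h(2)
      by (cases i; cases j) (auto simp: ferrers_def diagram_of_def Suc_le_eq)
    then show ?thesis by auto
  qed
  finally show "ferrers (right_part a l) = diagram_of h" .
qed

text \<open>Below the Durfee rectangle no row is longer than \<open>m + a\<close>, since otherwise the rectangle could be
enlarged by one row and one column.\<close>

lemma glue_surj:
  assumes l: "l \<in> partitions_of n"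
  shows "\<exists>m h b. h \<in> profile \<and> h 0 \<le> m \<and> sorted_wrt (\<ge>) b \<and> set b \<subseteq> {1..m + a} \<and>
    l = glue m (m + a) h b"
proof -
  have sorted: "sorted_wrt (\<ge>) l" and pos: "\<forall>p\<in>set l. 0 < p"
    using l by (auto simp: partitions_of_def)
  let ?P = "\<lambda>k. {1..k} \<times> {1..k + a} \<subseteq> ferrers l"
  define m where "m = durfee a l"
  have bound: "k \<le> length l" if "?P k" for k
    using durfee_rectangle_iff[OF sorted, of k a] that by (cases "k = 0") auto
  have Pm: "?P m" unfolding m_def durfee_def by (rule GreatestI_nat[of ?P 0 "length l"]) (use bound in auto)
  have not_P: "\<not> ?P (m + 1)"
    using Greatest_le_nat[of ?P "m + 1" "length l"] bound unfolding m_def durfee_def by auto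
  have mono: "l ! j \<le> l ! i" if "i \<le> j" "j < length l" for i j
    using sorted_wrt_nth_less[OF sorted, of i j] that by (cases "i = j") auto
  have len: "m \<le> length l" by (rule bound[OF Pm])
  have ge: "m + a \<le> l ! i" if "i < m" for i
  proof -
    have "m + a \<le> l ! (m - 1)" using durfee_rectangle_iff[OF sorted, of m a] Pm that by simp
    also have "\<dots> \<le> l ! i" by (rule mono) (use that len in auto)
    finally show ?thesis .
  qed
  have le: "p \<le> m + a" if "p \<in> set (drop m l)" for p
  proof -
    obtain i where "i < length (drop m l)" "drop m l ! i = p"
      using \<open>p \<in> set (drop m l)\<close> by (metis in_set_conv_nth)
    then have i: "m + i < length l" "p = l ! (m + i)" using len by simp_all
    then have "m < length l" by simp
    then have "l ! m < m + 1 + a"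
      using not_P durfee_rectangle_iff[OF sorted, of "m + 1" a] by auto
    then show ?thesis using mono[of m "m + i"] i by simp
  qed
  define rows where "rows = (\<lambda>i. if i < m then l ! i - (m + a) else 0)"
  have "rows j \<le> rows i" if "i \<le> j" for i j
    using mono[of i j] that len by (auto simp: rows_def)
  then have rows: "rows \<in> profile"
    by (auto simp: profile_def antimono_def rows_def intro!: exI[of _ m])
  have "conjugate rows 0 \<le> m" using conjugate_le_iff[OF rows, of 0 m] by (simp add: rows_def)
  moreover have "l = glue m (m + a) (conjugate rows) (drop m l)"
  proof -
    have "take m l = map (\<lambda>i. rows i + (m + a)) [0..<m]"
      using len ge by (intro nth_equalityI) (auto simp: rows_def)
    then show ?thesis unfolding glue_def conjugate_conjugate[OF rows]
      by (metis append_take_drop_id)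
  qed
  moreover have "sorted_wrt (\<ge>) (drop m l)" using sorted by (rule sorted_wrt_drop)
  moreover have "set (drop m l) \<subseteq> {1..m + a}"
    using le pos set_drop_subset[of m l] by fastforce
  ultimately show ?thesis using conjugate_profile[OF rows] by blast
qed

section \<open>Partitions as triples\<close>

text \<open>For \<open>c = m + a\<close>, the rows below the Durfee rectangle have length at most \<open>c\<close> and the stripped hooks,
having \<open>v + c\<close> cells with \<open>1 \<le> v \<le> m\<close>, have length between \<open>c + 1\<close> and \<open>2 * m + a\<close>. One multiset
\<open>P\<close> of parts up to \<open>2 * m + a\<close> can therefore carry both.\<close>

definition hooks_of :: "nat \<Rightarrow> nat multiset \<Rightarrow> nat list" where
  "hooks_of c P = map (\<lambda>p. p - c) (sorted_list_of_multiset (filter_mset (\<lambda>p. c < p) P))"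

definition low_parts :: "nat \<Rightarrow> nat multiset \<Rightarrow> nat list" where
  "low_parts c P = rev (sorted_list_of_multiset (filter_mset (\<lambda>p. p \<le> c) P))"

text \<open>The data \<open>(m, D, P)\<close>: side of the Durfee rectangle, residual diagram, multiset of remaining parts.\<close>

definition triples :: "nat \<Rightarrow> nat \<Rightarrow> (nat \<times> diagram \<times> nat multiset) set" where
  "triples a n = {(m, D, P). D \<in> box (int m) (int (m + a)) \<and> set_mset P \<subseteq> {1..2 * m + a} \<and>
     m * (m + a) + card D + sum_mset P = n}"

definition assemble :: "nat \<Rightarrow> nat \<times> diagram \<times> nat multiset \<Rightarrow> nat list" where
  "assemble a = (\<lambda>(m, D, P).
     glue m (m + a) (build (m + a) (heights D) (hooks_of (m + a) P)) (low_parts (m + a) P))"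

lemma box_heights:
  assumes "D \<in> box (int m) (int c)"
  shows "heights D \<in> profile" "heights D 0 \<le> m" "heights D c = 0" "diagram_of (heights D) = D"
    "weight (heights D) = card D"
proof -
  have cell: "p \<le> m \<and> q \<le> c" if "(p, q) \<in> D" for p q
    using assms that by (auto simp: box_def)
  have D: "D \<in> young" using assms by (auto simp: box_def)
  show p: "heights D \<in> profile" and d: "diagram_of (heights D) = D"
    by (rule heights_profile[OF D], rule diagram_of_heights[OF D])
  show "heights D 0 \<le> m"
  proof (cases "heights D 0 = 0")
    case False
    then have "(heights D 0, 1) \<in> diagram_of (heights D)" by (simp add: diagram_of_def)
    then show ?thesis using cell d by metis
  qed simp
  show "heights D c = 0"
  proof (rule ccontr)
    assume "heights D c \<noteq> 0"
    then have "(1, c + 1) \<in> diagram_of (heights D)" by (simp add: diagram_of_def)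
    then have "c + 1 \<le> c" using cell d by metis
    then show False by simp
  qed
  show "weight (heights D) = card D" using card_diagram_of[OF p] d by simp
qed

lemma diagram_of_box:
  assumes "R \<in> profile" "R 0 \<le> m" "R c = 0"
  shows "diagram_of R \<in> box (int m) (int c)"
proof -
  have "p \<le> m \<and> q \<le> c" if "(p, q) \<in> diagram_of R" for p q
  proof -
    have pq: "1 \<le> p" "1 \<le> q" "p \<le> R (q - 1)" using that by (auto simp: diagram_of_def)
    then show ?thesis
      using profileD[OF assms(1), of 0 "q - 1"] profileD[OF assms(1), of c "q - 1"] assms
      by (cases "c \<le> q - 1") auto
  qed
  then show ?thesis using diagram_of_young[OF assms(1)] by (auto simp: box_def)
qed

lemma hooks_of:
  assumes "set_mset P \<subseteq> {1..m + c}"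
  shows "sorted (hooks_of c P)" "set (hooks_of c P) \<subseteq> {1..m}"
    "image_mset (\<lambda>v. v + c) (mset (hooks_of c P)) = filter_mset (\<lambda>p. c < p) P"
proof -
  have "sorted (sorted_list_of_multiset (filter_mset (\<lambda>p. c < p) P))" by simp
  then show "sorted (hooks_of c P)"
    unfolding hooks_of_def sorted_map by (rule sorted_wrt_mono_rel[rotated]) simp
  show "set (hooks_of c P) \<subseteq> {1..m}"
  proof
    fix v assume "v \<in> set (hooks_of c P)"
    then obtain p where p: "p \<in># P" "c < p" "v = p - c" by (auto simp: hooks_of_def)
    then have "p \<le> m + c" using assms by auto
    then show "v \<in> {1..m}" using p by auto
  qed
  have "image_mset (\<lambda>v. v + c) (mset (hooks_of c P))
      = image_mset (\<lambda>p. p - c + c) (filter_mset (\<lambda>p. c < p) P)"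
    unfolding hooks_of_def mset_map by (simp add: multiset.map_comp comp_def)
  also have "\<dots> = image_mset (\<lambda>p. p) (filter_mset (\<lambda>p. c < p) P)"
    by (rule image_mset_cong) auto
  finally show "image_mset (\<lambda>v. v + c) (mset (hooks_of c P)) = filter_mset (\<lambda>p. c < p) P" by simp
qed

lemma low_parts:
  assumes "set_mset P \<subseteq> {1..m}"
  shows "sorted_wrt (\<ge>) (low_parts c P)" "set (low_parts c P) \<subseteq> {1..c}"
    "mset (low_parts c P) = filter_mset (\<lambda>p. p \<le> c) P"
  using assms by (auto simp: low_parts_def sorted_wrt_rev)

lemma split_parts: "P = filter_mset (\<lambda>p. p \<le> c) P + filter_mset (\<lambda>p. c < p) (P :: nat multiset)"
  using multiset_partition[of P "\<lambda>p. p \<le> c"] by (simp add: not_le)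

lemma assemble:
  assumes "(m, D, P) \<in> triples a n"
  defines "h \<equiv> build (m + a) (heights D) (hooks_of (m + a) P)"
  shows "assemble a (m, D, P) \<in> partitions_of n" "durfee a (assemble a (m, D, P)) = m"
    "ferrers (right_part a (assemble a (m, D, P))) = diagram_of h"
    "residual a (assemble a (m, D, P)) = D"
proof -
  let ?c = "m + a"
  have D: "D \<in> box (int m) (int ?c)" and P: "set_mset P \<subseteq> {1..m + ?c}"
    and n: "n = m * ?c + card D + sum_mset P"
    using assms by (auto simp: triples_def mult_2 add.assoc)
  note hd = box_heights[OF D]
  note hk = hooks_of[OF P]
  have vs: "\<forall>v\<in>set (hooks_of ?c P). 1 \<le> v" "\<forall>v\<in>set (hooks_of ?c P). v \<le> m" using hk(2) by auto
  note b = build_profile[OF hd(1,3) hk(1) vs(1), folded h_def]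
  note low = low_parts[OF P, of ?c]
  have l: "assemble a (m, D, P) = glue m ?c h (low_parts ?c P)"
    by (simp add: assemble_def h_def)
  note g = glue[OF b(1) b(3)[OF hd(2) vs(2)] low(1,2), folded l]
  have "sum_mset P = sum_list (low_parts ?c P) + (\<Sum>v\<leftarrow>hooks_of ?c P. v + ?c)"
    by (subst split_parts[of P ?c])
      (simp only: sum_mset.union hk(3)[symmetric] low(3)[symmetric] sum_mset_sum_list[symmetric] mset_map)
  then show "assemble a (m, D, P) \<in> partitions_of n" using g(1) b(2) hd(5) n by (simp add: add_ac)
  show "durfee a (assemble a (m, D, P)) = m" by (rule g(2))
  show "ferrers (right_part a (assemble a (m, D, P))) = diagram_of h" by (rule g(3))
  show "residual a (assemble a (m, D, P)) = D"
    unfolding residual_def g(2,3) b(4) by (rule hd(4))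
qed

text \<open>A combinatorial form of the identity
\<open>1 / (q)\<^sub>m = [2 * m + a choose m] * (q)\<^bsub>m+a\<^esub> / (q)\<^bsub>2*m+a\<^esub>\<close> applied to the part of the
partition to the right of the Durfee rectangle: by \<open>build_surj\<close> and \<open>build_inj\<close> that part is a residual
diagram in an \<open>m\<close> by \<open>m + a\<close> box together with a multiset of hook lengths.\<close>

lemma bij_betw_assemble: "bij_betw (assemble a) (triples a n) (partitions_of n)"
proof (rule bij_betwI')
  fix t t' assume t: "t \<in> triples a n" "t' \<in> triples a n"
  obtain m D P m' D' P' where tt: "t = (m, D, P)" "t' = (m', D', P')" by (metis prod_cases3)
  note s = assemble[OF t(1)[unfolded tt]] and s' = assemble[OF t(2)[unfolded tt]]
  show "(assemble a t = assemble a t') = (t = t')"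
  proof
    assume eq: "assemble a t = assemble a t'"
    have m: "m' = m" using s(2) s'(2) eq tt by simp
    have D: "D' = D" using s(4) s'(4) eq tt by simp
    let ?c = "m + a"
    have box: "D \<in> box (int m) (int ?c)" and P: "set_mset P \<subseteq> {1..m + ?c}"
      "set_mset P' \<subseteq> {1..m + ?c}"
      using t tt m by (auto simp: triples_def mult_2 add.assoc)
    note hd = box_heights[OF box]
    have "diagram_of (build ?c (heights D) (hooks_of ?c P))
        = diagram_of (build ?c (heights D) (hooks_of ?c P'))"
      using s(3) s'(3) eq tt unfolding m D by simp
    then have b: "build ?c (heights D) (hooks_of ?c P) = build ?c (heights D) (hooks_of ?c P')"
      by (metis heights_diagram_of)
    then have hk: "hooks_of ?c P = hooks_of ?c P'"
      using hooks_of[OF P(1)] hooks_of[OF P(2)] by (intro build_inj[OF hd(1,3)]) auto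
    have "low_parts ?c P = low_parts ?c P'"
      using eq unfolding tt m D assemble_def glue_def b prod.case by simp
    then show "t = t'"
      using hk hooks_of(3)[OF P(1)] hooks_of(3)[OF P(2)] low_parts(3)[OF P(1)] low_parts(3)[OF P(2)]
        split_parts[of P ?c] split_parts[of P' ?c] tt m D by metis
  qed simp
next
  fix t assume "t \<in> triples a n"
  then show "assemble a t \<in> partitions_of n" using assemble(1) by (metis prod_cases3)
next
  fix l assume l: "l \<in> partitions_of n"
  obtain m h b where h: "h \<in> profile" "h 0 \<le> m" and b: "sorted_wrt (\<ge>) b" "set b \<subseteq> {1..m + a}"
    and lg: "l = glue m (m + a) h b"
    using glue_surj[OF l] by blast
  let ?c = "m + a"
  obtain R vs where R: "R \<in> profile" "R ?c = 0" "R 0 \<le> m" "sorted vs" "set vs \<subseteq> {1..m}"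
    and hb: "h = build ?c R vs"
    using build_surj[OF h, of ?c] by blast
  define P where "P = mset b + image_mset (\<lambda>v. v + ?c) (mset vs)"
  have hi: "filter_mset (\<lambda>p. ?c < p) P = mset (map (\<lambda>v. v + ?c) vs)"
  proof -
    have "filter_mset (\<lambda>p. ?c < p) (mset b) = {#}" using b(2) by (auto simp: filter_mset_eq_conv)
    moreover have "filter_mset (\<lambda>p. ?c < p) (mset (map (\<lambda>v. v + ?c) vs)) = mset (map (\<lambda>v. v + ?c) vs)"
      using R(5) by (auto simp: filter_mset_eq_conv)
    ultimately show ?thesis by (simp add: P_def)
  qed
  have lo: "filter_mset (\<lambda>p. p \<le> ?c) P = mset (rev b)"
  proof -
    have "filter_mset (\<lambda>p. p \<le> ?c) (mset (map (\<lambda>v. v + ?c) vs)) = {#}"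
      using R(5) by (auto simp: filter_mset_eq_conv)
    moreover have "filter_mset (\<lambda>p. p \<le> ?c) (mset b) = mset b"
      using b(2) by (auto simp: filter_mset_eq_conv)
    ultimately show ?thesis by (simp add: P_def)
  qed
  have "sorted (map (\<lambda>v. v + ?c) vs)"
    unfolding sorted_map using R(4) by (rule sorted_wrt_mono_rel[rotated]) simp
  then have hk: "hooks_of ?c P = vs"
    unfolding hooks_of_def hi sorted_list_of_multiset_mset by (simp add: sorted_sort_id comp_def)
  have lp: "low_parts ?c P = b"
    unfolding low_parts_def lo sorted_list_of_multiset_mset
    using b(1) by (simp add: sorted_sort_id sorted_wrt_rev)
  have al: "assemble a (m, diagram_of R, P) = l"
    unfolding assemble_def prod.case heights_diagram_of hk lp lg hb ..
  have "set_mset P \<subseteq> {1..2 * m + a}" using b(2) R(5) by (fastforce simp: P_def)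
  then have T: "(m, diagram_of R, P) \<in> triples a (m * ?c + card (diagram_of R) + sum_mset P)"
    using diagram_of_box[OF R(1,3,2)] by (simp add: triples_def)
  have "m * ?c + card (diagram_of R) + sum_mset P = n"
    using assemble(1)[OF T] l al by (simp add: partitions_of_def)
  then show "\<exists>t\<in>triples a n. l = assemble a t" using T al by auto
qed

section \<open>Partitions with large hook rank\<close>

lemma hook_rank_ge_iff:
  "int r \<le> hook_rank a l \<longleftrightarrow> exceeds (int (durfee a l)) (int r) (residual a l)"
proof -
  let ?R = "residual a l" and ?m = "int (durfee a l)"
  have "hook_rank a l = Max (gap ?m ?R ` {0..diag_len ?R}) - 1"
    unfolding hook_rank_def Let_def gap_def leg_seq_def arm_seq_def ..
  moreover have "int r < Max (gap ?m ?R ` {0..diag_len ?R}) \<longleftrightarrow>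
      (\<exists>g\<in>gap ?m ?R ` {0..diag_len ?R}. int r < g)"
    by (rule Max_gr_iff) auto
  ultimately show ?thesis by (auto simp: exceeds_def)
qed

text \<open>The last gap \<open>y\<^sub>d + 1\<close> is positive, so with a nonpositive threshold the reflection is defined on every
diagram.\<close>

lemma exceeds_neg:
  "0 \<le> k \<Longrightarrow> 0 \<le> r \<Longrightarrow> exceeds k (- r) D"
  unfolding exceeds_def gap_def
  by (rule exI[of _ "diag_len D"]) (auto simp: arm_seq_def leg_seq_def)

text \<open>The reflection turns an \<open>m\<close> by \<open>m + a\<close> box into a \<open>k\<close> by \<open>k + b\<close> box with \<open>k = m - r\<close> and
\<open>b = a + 2 * r\<close>. Then \<open>2 * k + b = 2 * m + a\<close>, so the bound on \<open>P\<close> is the same on both sides, and the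
rectangles differ by \<open>m * (m + a) - k * (k + b) = r * (r + a)\<close> cells.\<close>

lemma bij_betw_swap_triples:
  assumes "r * (r + a) \<le> n"
  shows "bij_betw (\<lambda>(m, D, P). (m - r, tail_swap (int m) (int r) D, P))
     {(m, D, P) \<in> triples a n. exceeds (int m) (int r) D} (triples (a + 2 * r) (n - r * (r + a)))"
    (is "bij_betw ?f ?S ?T")
proof (rule bij_betw_byWitness)
  let ?g = "\<lambda>(k, D, P). (k + r, tail_swap (int k) (- int r) D, P)"
  have area: "(k + r) * (k + r + a) = k * (k + (a + 2 * r)) + r * (r + a)" for k
    by (simp add: algebra_simps)
  have fwd: "?f (m, D, P) \<in> ?T \<and> ?g (?f (m, D, P)) = (m, D, P)"
    if S: "(m, D, P) \<in> triples a n" "exceeds (int m) (int r) D" for m D P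
  proof -
    have D: "D \<in> box (int m) (int (m + a))" and P: "set_mset P \<subseteq> {1..2 * m + a}"
      and n: "n = m * (m + a) + card D + sum_mset P" using S by (auto simp: triples_def)
    note t = tail_swap[OF D _ _ S(2)]
    have "r \<le> m" using t(1) by simp
    then obtain k where k: "m = k + r" by (metis add.commute le_Suc_ex)
    have E: "tail_swap (int m) (int r) D \<in> box (int k) (int (k + (a + 2 * r)))"
      "card (tail_swap (int m) (int r) D) = card D"
      "tail_swap (int k) (- int r) (tail_swap (int m) (int r) D) = D"
      using t(2,3,5) by (simp_all add: k algebra_simps)
    show ?thesis using E P n area[of k] by (simp add: k triples_def algebra_simps)
  qed
  have bwd: "?g (k, D, P) \<in> ?S \<and> ?f (?g (k, D, P)) = (k, D, P)" if T: "(k, D, P) \<in> ?T" for k D P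
  proof -
    have D: "D \<in> box (int k) (int (k + (a + 2 * r)))" and P: "set_mset P \<subseteq> {1..2 * k + (a + 2 * r)}"
      and n: "n - r * (r + a) = k * (k + (a + 2 * r)) + card D + sum_mset P"
      using T by (auto simp: triples_def)
    note t = tail_swap[OF D _ _ exceeds_neg[of "int k" "int r"]]
    have E: "tail_swap (int k) (- int r) D \<in> box (int (k + r)) (int (k + r + a))"
      "card (tail_swap (int k) (- int r) D) = card D"
      "exceeds (int (k + r)) (int r) (tail_swap (int k) (- int r) D)"
      "tail_swap (int (k + r)) (int r) (tail_swap (int k) (- int r) D) = D"
      using t(2-5) by (simp_all add: algebra_simps)
    show ?thesis using E P n area[of k] assms by (simp add: triples_def algebra_simps)
  qed
  show "\<forall>t\<in>?S. ?g (?f t) = t" using fwd by auto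
  show "\<forall>t\<in>?T. ?f (?g t) = t" using bwd by auto
  show "?f ` ?S \<subseteq> ?T" using fwd by auto
  show "?g ` ?T \<subseteq> ?S" using bwd by auto
qed

lemma card_hook_rank_ge:
  "card {l \<in> partitions_of n. int r \<le> hook_rank a l} =
     (if r * (r + a) \<le> n then card (partitions_of (n - r * (r + a))) else 0)"
proof -
  let ?S = "{(m, D, P) \<in> triples a n. exceeds (int m) (int r) D}"
  have iff: "int r \<le> hook_rank a (assemble a (m, D, P)) \<longleftrightarrow> exceeds (int m) (int r) D"
    if "(m, D, P) \<in> triples a n" for m D P
    unfolding hook_rank_ge_iff assemble(2,4)[OF that] ..
  have img: "assemble a ` triples a n = partitions_of n" and inj: "inj_on (assemble a) (triples a n)"
    using bij_betw_assemble by (auto simp: bij_betw_def)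
  have "{l \<in> partitions_of n. int r \<le> hook_rank a l} = assemble a ` ?S"
    unfolding img[symmetric] using iff by auto
  moreover have "inj_on (assemble a) ?S" using inj by (rule inj_on_subset) auto
  ultimately have card: "card {l \<in> partitions_of n. int r \<le> hook_rank a l} = card ?S"
    by (simp add: card_image)
  show ?thesis
  proof (cases "r * (r + a) \<le> n")
    case True
    have "card ?S = card (triples (a + 2 * r) (n - r * (r + a)))"
      by (rule bij_betw_same_card[OF bij_betw_swap_triples[OF True]])
    also have "\<dots> = card (partitions_of (n - r * (r + a)))"
      by (rule bij_betw_same_card[OF bij_betw_assemble])
    finally show ?thesis using card True by simp
  next
    case False
    have "False" if S: "(m, D, P) \<in> triples a n" "exceeds (int m) (int r) D" for m D P
    proof -
      have D: "D \<in> box (int m) (int (m + a))" and n: "m * (m + a) \<le> n"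
        using S by (auto simp: triples_def)
      have "r \<le> m" using tail_swap(1)[OF D _ _ S(2)] by simp
      then have "r * (r + a) \<le> m * (m + a)" by (intro mult_le_mono) auto
      then show False using n False by simp
    qed
    then have "?S = {}" by auto
    then have "card ?S = 0" by (metis card.empty)
    then show ?thesis using card False by simp
  qed
qed

section \<open>Partitions with large mex\<close>

definition partition_msets :: "nat \<Rightarrow> nat multiset set" where
  "partition_msets n = {M. 0 \<notin># M \<and> sum_mset M = n}"

lemma bij_betw_mset_partitions: "bij_betw mset (partitions_of n) (partition_msets n)"
proof (rule bij_betw_byWitness[where f' = "\<lambda>M. rev (sorted_list_of_multiset M)"])
  have "rev (sort l) = l" if "sorted_wrt (\<ge>) l" for l :: "nat list"
  proof -
    have "sorted (rev l)" using that by (simp add: sorted_wrt_rev)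
    then have "sort l = rev l" by (intro properties_for_sort) auto
    then show ?thesis by simp
  qed
  then show "\<forall>l\<in>partitions_of n. rev (sorted_list_of_multiset (mset l)) = l"
    by (auto simp: partitions_of_def sorted_list_of_multiset_mset)
  show "\<forall>M\<in>partition_msets n. mset (rev (sorted_list_of_multiset M)) = M" by simp
  show "mset ` partitions_of n \<subseteq> partition_msets n"
    by (auto simp: partitions_of_def partition_msets_def sum_mset_sum_list)
  show "(\<lambda>M. rev (sorted_list_of_multiset M)) ` partition_msets n \<subseteq> partitions_of n"
  proof clarify
    fix M assume M: "M \<in> partition_msets n"
    let ?l = "rev (sorted_list_of_multiset M)"
    have "sum_list ?l = sum_mset (mset ?l)" by (rule sum_mset_sum_list[symmetric])
    then have "sum_list ?l = n" using M by (simp add: partition_msets_def)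
    moreover have "0 \<notin> set ?l" using M by (simp add: partition_msets_def)
    then have "\<forall>p\<in>set ?l. 0 < p" by (metis neq0_conv)
    moreover have "sorted_wrt (\<ge>) ?l" by (simp add: sorted_wrt_rev)
    ultimately show "?l \<in> partitions_of n" by (simp add: partitions_of_def)
  qed
qed

text \<open>Remove one copy of each element of \<open>K\<close>.\<close>

lemma card_partitions_containing:
  assumes "finite K" "0 \<notin> K"
  shows "card {l \<in> partitions_of n. K \<subseteq> set l} =
    (if \<Sum>K \<le> n then card (partitions_of (n - \<Sum>K)) else 0)"
proof -
  let ?S = "{M \<in> partition_msets n. K \<subseteq> set_mset M}"
  have img: "mset ` partitions_of n = partition_msets n" and inj: "inj_on mset (partitions_of n)"
    using bij_betw_mset_partitions by (auto simp: bij_betw_def)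
  have sum: "sum_mset (mset_set K) = \<Sum>K" by (simp add: sum_unfold_sum_mset)
  have sub: "mset_set K \<subseteq># M \<longleftrightarrow> K \<subseteq> set_mset M" for M
    using assms(1) by (auto simp: subseteq_mset_def count_mset_set' subset_iff Suc_le_eq)
  have split: "M - mset_set K + mset_set K = M" if "K \<subseteq> set_mset M" for M
    using that sub by (intro subset_mset.diff_add) simp
  have weight: "sum_mset M = sum_mset (M - mset_set K) + \<Sum>K" if "K \<subseteq> set_mset M" for M
    using sum_mset.union[of "M - mset_set K" "mset_set K"] unfolding split[OF that] sum .
  have "mset ` {l \<in> partitions_of n. K \<subseteq> set l} = ?S" unfolding img[symmetric] by auto
  moreover have "inj_on mset {l \<in> partitions_of n. K \<subseteq> set l}"
    using inj by (rule inj_on_subset) auto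
  ultimately have card: "card {l \<in> partitions_of n. K \<subseteq> set l} = card ?S"
    using card_image by fastforce
  show ?thesis
  proof (cases "\<Sum>K \<le> n")
    case True
    have "bij_betw (\<lambda>M. M + mset_set K) (partition_msets (n - \<Sum>K)) ?S"
    proof (rule bij_betw_byWitness[where f' = "\<lambda>M. M - mset_set K"])
      show "\<forall>M\<in>?S. M - mset_set K + mset_set K = M" using split by blast
      show "(\<lambda>M. M + mset_set K) ` partition_msets (n - \<Sum>K) \<subseteq> ?S"
      proof clarify
        fix M assume "M \<in> partition_msets (n - \<Sum>K)"
        then show "M + mset_set K \<in> partition_msets n \<and> K \<subseteq> set_mset (M + mset_set K)"
          using assms True by (simp add: partition_msets_def sum)
      qed
      show "(\<lambda>M. M - mset_set K) ` ?S \<subseteq> partition_msets (n - \<Sum>K)"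
      proof clarify
        fix M assume M: "M \<in> partition_msets n" "K \<subseteq> set_mset M"
        have "0 \<notin># M - mset_set K" using M(1) in_diffD[of 0 M] by (auto simp: partition_msets_def)
        then show "M - mset_set K \<in> partition_msets (n - \<Sum>K)"
          using M(1) weight[OF M(2)] by (auto simp: partition_msets_def)
      qed
    qed simp
    then have "card ?S = card (partition_msets (n - \<Sum>K))" by (rule bij_betw_same_card[symmetric])
    also have "\<dots> = card (partitions_of (n - \<Sum>K))"
      by (rule bij_betw_same_card[OF bij_betw_mset_partitions, symmetric])
    finally show ?thesis using card True by simp
  next
    case False
    have "M \<notin> ?S" for M using weight[of M] False by (auto simp: partition_msets_def)
    then have "?S = {}" by blast
    then have "card ?S = 0" by (simp only: card.empty)
    then show ?thesis using card False by simp
  qed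
qed

text \<open>The first \<open>r\<close> positive odd (\<open>a = 0\<close>) or even (\<open>a = 1\<close>) integers.\<close>

definition progression :: "nat \<Rightarrow> nat \<Rightarrow> nat set" where
  "progression a r = (\<lambda>i. 2 * i + 1 + a) ` {..<r}"

lemma sum_progression: "\<Sum>(progression a r) = r * (r + a)"
proof -
  have "\<Sum>(progression a r) = (\<Sum>i<r. 2 * i + 1 + a)"
    unfolding progression_def by (subst sum.reindex) (auto simp: inj_on_def)
  also have "\<dots> = r * (r + a)" by (induction r) (auto simp: algebra_simps)
  finally show ?thesis .
qed

lemma Least_progression_iff:
  fixes l :: "nat list"
  assumes Q: "\<And>k. Q k \<longleftrightarrow> (\<exists>i. k = 2 * i + 1 + a)"
  shows "(LEAST k. Q k \<and> k \<notin> set l) = 2 * r + 1 + a \<longleftrightarrow>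
     progression a r \<subseteq> set l \<and> \<not> progression a (Suc r) \<subseteq> set l"
proof
  assume eq: "(LEAST k. Q k \<and> k \<notin> set l) = 2 * r + 1 + a"
  have "inj (\<lambda>i. 2 * i + 1 + a)" by (auto simp: inj_def)
  then have "infinite (range (\<lambda>i. 2 * i + 1 + a))" by (simp add: finite_image_iff)
  then have "\<not> range (\<lambda>i. 2 * i + 1 + a) \<subseteq> set l" by (meson finite_set finite_subset)
  then have "\<exists>k. Q k \<and> k \<notin> set l" using Q by auto
  then have "2 * r + 1 + a \<notin> set l" by (metis (mono_tags, lifting) LeastI_ex eq)
  moreover have "2 * i + 1 + a \<in> set l" if "i < r" for i
    using not_less_Least[of "2 * i + 1 + a" "\<lambda>k. Q k \<and> k \<notin> set l"] that Q unfolding eq by auto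
  ultimately show "progression a r \<subseteq> set l \<and> \<not> progression a (Suc r) \<subseteq> set l"
    by (auto simp: progression_def)
next
  assume "progression a r \<subseteq> set l \<and> \<not> progression a (Suc r) \<subseteq> set l"
  then have r: "2 * r + 1 + a \<notin> set l" and less: "\<forall>i<r. 2 * i + 1 + a \<in> set l"
    by (auto simp: progression_def lessThan_Suc)
  show "(LEAST k. Q k \<and> k \<notin> set l) = 2 * r + 1 + a"
  proof (rule Least_equality)
    show "Q (2 * r + 1 + a) \<and> 2 * r + 1 + a \<notin> set l" using Q r by auto
    show "2 * r + 1 + a \<le> k" if "Q k \<and> k \<notin> set l" for k
    proof -
      have "Q k" "k \<notin> set l" using that by auto
      obtain i where i: "k = 2 * i + 1 + a" using \<open>Q k\<close> unfolding Q by blast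
      have "\<not> i < r" using less \<open>k \<notin> set l\<close> unfolding i by blast
      then show ?thesis by (simp add: i)
    qed
  qed
qed

section \<open>Equidistribution\<close>

text \<open>The mex of residue class \<open>a\<close> and the hook rank have the same tail counts for every threshold, hence the
same distribution.\<close>

lemma card_mex_eq_card_hook_rank:
  assumes Q: "\<And>k. Q k \<longleftrightarrow> (\<exists>i. k = 2 * i + 1 + a)"
  shows "card {l \<in> partitions_of n. (LEAST k. Q k \<and> k \<notin> set l) = 2 * r + 1 + a} =
    card {l \<in> partitions_of n. hook_rank a l = int r}"
proof -
  define A where "A s = {l \<in> partitions_of n. progression a s \<subseteq> set l}" for s
  define B where "B s = {l \<in> partitions_of n. int s \<le> hook_rank a l}" for s
  have fin: "finite (A s)" "finite (B s)" for s
    using finite_partitions_of[of n] by (auto simp: A_def B_def)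
  have tails: "card (A s) = card (B s)" for s
  proof -
    have "finite (progression a s)" "0 \<notin> progression a s" by (auto simp: progression_def)
    note card_partitions_containing[OF this, of n]
    then show ?thesis by (simp add: A_def B_def card_hook_rank_ge sum_progression)
  qed
  have sub: "A (Suc r) \<subseteq> A r" "B (Suc r) \<subseteq> B r"
    by (auto simp: A_def B_def progression_def lessThan_Suc)
  have "{l \<in> partitions_of n. (LEAST k. Q k \<and> k \<notin> set l) = 2 * r + 1 + a} = A r - A (Suc r)"
    unfolding Least_progression_iff[OF Q] by (auto simp: A_def)
  moreover have "{l \<in> partitions_of n. hook_rank a l = int r} = B r - B (Suc r)"
    by (auto simp: B_def)
  ultimately show ?thesis
    using card_Diff_subset[OF fin(1) sub(1)] card_Diff_subset[OF fin(2) sub(2)] tails by simp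
qed

theorem theorem1:
  fixes n r :: nat
  shows "card {l \<in> partitions_of n. mex21 l = 2 * r + 1}
           = card {l \<in> partitions_of n. sqrank l = int r}
       \<and> card {l \<in> partitions_of n. mex22 l = 2 * r + 2}
           = card {l \<in> partitions_of n. rerank l = int r}"
proof
  have "0 < k \<and> odd k \<longleftrightarrow> (\<exists>i. k = 2 * i + 1 + 0)" for k :: nat
    by (auto elim: oddE)
  from card_mex_eq_card_hook_rank[of "\<lambda>k. 0 < k \<and> odd k", OF this, of n r]
  show "card {l \<in> partitions_of n. mex21 l = 2 * r + 1}
      = card {l \<in> partitions_of n. sqrank l = int r}"
    by (simp add: mex21_def sqrank_def conj_assoc)
  have "0 < k \<and> even k \<longleftrightarrow> (\<exists>i. k = 2 * i + 1 + 1)" for k :: nat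
    by presburger
  from card_mex_eq_card_hook_rank[of "\<lambda>k. 0 < k \<and> even k", OF this, of n r]
  show "card {l \<in> partitions_of n. mex22 l = 2 * r + 2}
      = card {l \<in> partitions_of n. rerank l = int r}"
    by (simp add: mex22_def rerank_def conj_assoc)
qed

end
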